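(* There exist absolute constants $0<c_1\le c_2$ such that for every $n\ge 1$ and every symmetric function $f:\{0,1\}^n\to\{-1,1\}$ with $r(f)>1$, \[ c_1\, r(f)\log\!\left(\frac{n}{r(f)}\right)\;\le\;\log \|\hat f\|_1\;\le\; c_2\, r(f)\log\!\left(\frac{n}{r(f)}\right), \] i.e. $\log\|\hat f\|_1=\Theta\big(r(f)\log(n/r(f))\big)$. If $r(f)\le 1$, then $\|\hat f\|_1=\Theta(1)$ (bounded above and below by absolute positive constants).
   Context: A function $f:\{0,1\}^n\to\{-1,1\}$ is symmetric if $f(x)$ depends only on $|x|=\sum_i x_i$. Identify $\{0,1\}^n$ with $\mathbb{F}_2^n$. Every $f:\{0,1\}^n\to\mathbb{R}$ can be written uniquely as $f=\sum_{S\subseteq[n]}\hat f(S)\chi_S$, where $\chi_S(x)=(-1)^{\sum_{i\in S}x_i}$ and $\hat f(S)=\mathbb{E}_x[f(x)\chi_S(x)]$ with $x$ uniform. The spectral norm is $\|\hat f\|_1=\sum_{S\subseteq[n]}|\hat f(S)|$. Let $\mathrm{parity}(x)=(-1)^{\sum_i x_i}$. For a symmetric $f$, let $r_0$ and $r_1$ be the minimum integers less than $n/2$ such that $f(x)$ or $f(x)\cdot\mathrm{parity}(x)$ is constant for all $x$ with $|x|\in[r_0,n-r_1]$, and let $r(f)=\max\{r_0,r_1\}$. Logarithms are base 2.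
   Formalization: For even n, some symmetric f admit no integers r_0, r_1 less than n/2 as required (e.g. values +,+,- on the three middle layers), leaving r(f) undefined; the formal statement sets r(f)=n/2 for these f and agrees with the given definition in all other cases. *)

theory Defs
  imports Complex_Main "HOL-Library.FuncSet"
begin

text \<open>Points of the cube are extensional functions on \<open>{1..n}\<close>. A function on the cube is an
  arbitrary \<open>f :: (nat \<Rightarrow> nat) \<Rightarrow> real\<close>; every notion below only looks at its values on \<open>cube n\<close>.\<close>

definition cube :: "nat \<Rightarrow> (nat \<Rightarrow> nat) set" where
  "cube n = {1..n} \<rightarrow>\<^sub>E {0, 1}"

definition weight :: "nat \<Rightarrow> (nat \<Rightarrow> nat) \<Rightarrow> nat" where
  "weight n x = (\<Sum>i\<in>{1..n}. x i)"

definition sign_valued :: "nat \<Rightarrow> ((nat \<Rightarrow> nat) \<Rightarrow> real) \<Rightarrow> bool" where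
  "sign_valued n f \<longleftrightarrow> f \<in> cube n \<rightarrow> {-1, 1}"

definition symmetric_fun :: "nat \<Rightarrow> ((nat \<Rightarrow> nat) \<Rightarrow> real) \<Rightarrow> bool" where
  "symmetric_fun n f \<longleftrightarrow> (\<forall>x\<in>cube n. \<forall>y\<in>cube n. weight n x = weight n y \<longrightarrow> f x = f y)"

definition chi :: "nat set \<Rightarrow> (nat \<Rightarrow> nat) \<Rightarrow> real" where
  "chi S x = (-1) ^ (\<Sum>i\<in>S. x i)"

definition fourier_coeff :: "nat \<Rightarrow> ((nat \<Rightarrow> nat) \<Rightarrow> real) \<Rightarrow> nat set \<Rightarrow> real" where
  "fourier_coeff n f S = (\<Sum>x\<in>cube n. f x * chi S x) / real (card (cube n))"

definition spectral_norm :: "nat \<Rightarrow> ((nat \<Rightarrow> nat) \<Rightarrow> real) \<Rightarrow> real" where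
  "spectral_norm n f = (\<Sum>S\<in>Pow {1..n}. \<bar>fourier_coeff n f S\<bar>)"

definition parity :: "nat \<Rightarrow> (nat \<Rightarrow> nat) \<Rightarrow> real" where
  "parity n x = (-1) ^ (\<Sum>i\<in>{1..n}. x i)"

definition constant_on_layers :: "nat \<Rightarrow> ((nat \<Rightarrow> nat) \<Rightarrow> real) \<Rightarrow> nat set \<Rightarrow> bool" where
  "constant_on_layers n g K \<longleftrightarrow> (\<exists>c. \<forall>x\<in>cube n. weight n x \<in> K \<longrightarrow> g x = c)"

definition admissible :: "nat \<Rightarrow> ((nat \<Rightarrow> nat) \<Rightarrow> real) \<Rightarrow> nat \<Rightarrow> nat \<Rightarrow> bool" where
  "admissible n f a b \<longleftrightarrow>
     real a < real n / 2 \<and> real b < real n / 2 \<and>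
     (constant_on_layers n f {a..n - b} \<or>
      constant_on_layers n (\<lambda>x. f x * parity n x) {a..n - b})"

definition r0 :: "nat \<Rightarrow> ((nat \<Rightarrow> nat) \<Rightarrow> real) \<Rightarrow> nat" where
  "r0 n f = (LEAST a. \<exists>b. admissible n f a b)"

definition r1 :: "nat \<Rightarrow> ((nat \<Rightarrow> nat) \<Rightarrow> real) \<Rightarrow> nat" where
  "r1 n f = (LEAST b. \<exists>a. admissible n f a b)"

text \<open>For even \<open>n\<close> there may be no admissible pair at all: all candidate intervals contain the
  three middle layers, on which \<open>f\<close> may be neither constant nor alternating. Then no interval with
  \<open>max r\<^sub>0 r\<^sub>1 < n/2\<close> works, and \<open>r(f)\<close> is \<open>n/2\<close>, the value obtained by also
  allowing \<open>r\<^sub>0\<close> and \<open>r\<^sub>1\<close> to be equal to \<open>n/2\<close>.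
  The lemmas \<open>admissible_r0_r1\<close> and \<open>admissible_exists_odd\<close> show that \<open>r0\<close> and \<open>r1\<close>, although minimised
  separately, are attained together, and that the exceptional case needs \<open>n\<close> even.\<close>

definition r_of :: "nat \<Rightarrow> ((nat \<Rightarrow> nat) \<Rightarrow> real) \<Rightarrow> nat" where
  "r_of n f = (if \<exists>a b. admissible n f a b then max (r0 n f) (r1 n f) else n div 2)"

lemma layer_nonempty:
  assumes "k \<le> n"
  shows "\<exists>x\<in>cube n. weight n x = k"
proof
  let ?x = "\<lambda>i\<in>{1..n}. if i \<le> k then 1 else (0::nat)"
  show "?x \<in> cube n"
    by (auto simp: cube_def)
  have "weight n ?x = (\<Sum>i\<in>{1..n}. if i \<le> k then 1 else 0)"
    by (simp add: weight_def)
  also have "\<dots> = card ({1..n} \<inter> {i. i \<le> k})"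
    by (subst sum.If_cases) (auto simp: Int_def)
  also have "{1..n} \<inter> {i. i \<le> k} = {1..k}"
    using assms by auto
  finally show "weight n ?x = k"
    by (simp only: card_atLeastAtMost diff_Suc_1)
qed

lemma parity_weight: "parity n x = (-1) ^ weight n x"
  by (simp add: parity_def weight_def)

lemma constant_on_layers_union:
  assumes "constant_on_layers n g A" "constant_on_layers n g B" "k \<in> A" "k \<in> B" "k \<le> n"
  shows "constant_on_layers n g (A \<union> B)"
  using assms layer_nonempty[OF assms(5)] unfolding constant_on_layers_def by (metis Un_iff)

lemma not_constant_and_alternating:
  assumes "sign_valued n f" "constant_on_layers n f A"
    "constant_on_layers n (\<lambda>x. f x * parity n x) B"
    "k \<in> A \<inter> B" "Suc k \<in> A \<inter> B" "Suc k \<le> n"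
  shows False
proof -
  obtain x where x: "x \<in> cube n" "weight n x = k"
    using layer_nonempty[of k n] assms by auto
  obtain y where y: "y \<in> cube n" "weight n y = Suc k"
    using layer_nonempty[of "Suc k" n] assms by auto
  have "f x = f y"
    using assms x y unfolding constant_on_layers_def by (metis IntD1)
  moreover have "f x * parity n x = f y * parity n y"
    using assms x y unfolding constant_on_layers_def by (metis IntD2)
  moreover have "f x \<noteq> 0"
    using assms(1) x by (auto simp: sign_valued_def Pi_def)
  ultimately show False
    using x y by (simp add: parity_weight)
qed

lemma admissible_min:
  assumes f: "sign_valued n f" and 1: "admissible n f a b" and 2: "admissible n f a' b'"
  shows "admissible n f (min a a') (min b b')"
proof -
  define k where "k = (n - 1) div 2"
  have bd: "2 * a < n" "2 * b < n" "2 * a' < n" "2 * b' < n"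
    using 1 2 by (auto simp: admissible_def)
  have k: "k \<in> {a..n - b}" "k \<in> {a'..n - b'}" "Suc k \<in> {a..n - b}" "Suc k \<in> {a'..n - b'}"
      "Suc k \<le> n"
    using bd by (auto simp: k_def)
  have un: "{a..n - b} \<union> {a'..n - b'} = {min a a'..n - min b b'}"
    using k by (auto simp: min_def)
  have "constant_on_layers n f {min a a'..n - min b b'} \<or>
      constant_on_layers n (\<lambda>x. f x * parity n x) {min a a'..n - min b b'}"
    using 1 2 k constant_on_layers_union[of n _ "{a..n - b}" "{a'..n - b'}" k]
      not_constant_and_alternating[OF f, of "{a..n - b}" "{a'..n - b'}" k]
      not_constant_and_alternating[OF f, of "{a'..n - b'}" "{a..n - b}" k]
    unfolding admissible_def un by auto
  then show ?thesis
    using bd by (auto simp: admissible_def min_def)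
qed

lemma admissible_r0_r1:
  assumes "sign_valued n f" "admissible n f a b"
  shows "admissible n f (r0 n f) (r1 n f)" "r0 n f \<le> a" "r1 n f \<le> b"
proof -
  have le: "r0 n f \<le> a" "r1 n f \<le> b" if "admissible n f a b" for a b
    using that unfolding r0_def r1_def by (auto intro: Least_le)
  obtain b' where b': "admissible n f (r0 n f) b'"
    using LeastI_ex[of "\<lambda>a. \<exists>b. admissible n f a b"] assms(2) unfolding r0_def by blast
  obtain a' where a': "admissible n f a' (r1 n f)"
    using LeastI_ex[of "\<lambda>b. \<exists>a. admissible n f a b"] assms(2) unfolding r1_def by blast
  show "admissible n f (r0 n f) (r1 n f)"
    using admissible_min[OF assms(1) b' a'] le(2)[OF b'] le(1)[OF a'] by (simp add: min_absorb1 min_absorb2)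
  show "r0 n f \<le> a" "r1 n f \<le> b"
    using le assms(2) by auto
qed

lemma admissible_exists_odd:
  assumes "sign_valued n f" "symmetric_fun n f" "odd n"
  shows "admissible n f (n div 2) (n div 2)"
proof -
  define k where "k = n div 2"
  have n: "n = Suc (2 * k)"
    using assms(3) by (auto simp: k_def elim: oddE)
  obtain x where x: "x \<in> cube n" "weight n x = k"
    using layer_nonempty[of k n] n by auto
  obtain y where y: "y \<in> cube n" "weight n y = Suc k"
    using layer_nonempty[of "Suc k" n] n by auto
  have layer: "f z = (if weight n z = k then f x else f y)"
    if "z \<in> cube n" "weight n z \<in> {k..n - k}" for z
  proof -
    have "weight n z = k \<or> weight n z = Suc k"
      using that n by auto
    then show ?thesis
      using that(1) assms(2) x y unfolding symmetric_fun_def by (metis n_not_Suc_n)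
  qed
  have "f x \<in> {-1, 1}" "f y \<in> {-1, 1}"
    using assms(1) x y by (auto simp: sign_valued_def)
  then consider "f x = f y" | "f y = - f x"
    by auto
  then have "constant_on_layers n f {k..n - k} \<or>
      constant_on_layers n (\<lambda>x. f x * parity n x) {k..n - k}"
  proof cases
    case 1
    then show ?thesis
      using layer unfolding constant_on_layers_def by (intro disjI1 exI[of _ "f x"]) auto
  next
    case 2
    have "f z * parity n z = f x * (-1) ^ k" if "z \<in> cube n" "weight n z \<in> {k..n - k}" for z
    proof -
      have "weight n z = k \<or> weight n z = Suc k"
        using that n by auto
      then show ?thesis
        using layer[OF that] 2 by (auto simp: parity_weight)
    qed
    then show ?thesis
      unfolding constant_on_layers_def by blast
  qed
  then show ?thesis
    unfolding admissible_def k_def[symmetric] by (simp add: n)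
qed

end

theory Submission
  imports Defs "HOL-Computational_Algebra.Polynomial"
begin

text \<open>Write \<open>F k\<close> for the value of \<open>f\<close> on layer \<open>k\<close> and \<open>E\<close> for the shift of
  sequences. Summing out one coordinate gives
  \<open>N (n + 1) F = (N n (F + E F) + N n (F - E F)) / 2\<close> for the spectral norm \<open>N n F\<close>.

  Upper bound: up to parity, \<open>f\<close> is a constant plus point masses with coefficients \<open>\<plusminus>2\<close>
  on at most \<open>2 r\<close> extreme layers, and a point mass has spectral norm \<open>1\<close>.

  Lower bound for \<open>n/r\<close> bounded: two steps of the recursion and the triangle inequality give
  \<open>N (n + 2) F \<ge> N n (E F) + N n (D F) / 2\<close> with \<open>D = E\<^sup>2 - 1\<close>, hence
  \<open>N (2m) F \<ge> (m choose d) / 2\<^sup>d \<cdot> \<bar>D\<^sup>d F (m - d)\<bar>\<close>. The number \<open>D\<^sup>d F\<close> is an even integer, and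
  near \<open>r\<close> it is nonzero somewhere: otherwise \<open>F\<close> would agree with a polynomial of degree
  less than \<open>d\<close> on \<open>2d\<close> points of one parity class, which forces it to be constant there,
  whereas \<open>F (r - 1) \<noteq> F (r + 1)\<close> (up to the reflection \<open>k \<mapsto> n - k\<close>).

  Lower bound for \<open>n/r\<close> large: removing the constant leaves a function supported on the two
  extreme tails. Its Fourier transform is a polynomial of degree less than \<open>r\<close> plus parity times
  another one, so by hypercontractivity its \<open>L\<^sup>1\<close> norm is, up to a factor \<open>C\<^sup>r\<close>, at least its
  \<open>L\<^sup>2\<close> norm, which is at least \<open>sqrt (n choose (r - 1))\<close> by Parseval.\<close>

section \<open>Walsh transform and spectral norm of layer profiles\<close>

text \<open>For \<open>f x = F (weight n x)\<close>, \<open>walsh s F\<close> is \<open>2\<^sup>n\<close> times the Fourier coefficient of \<open>f\<close> at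
  the set whose membership vector is \<open>s\<close>; by symmetry the order of the coordinates is irrelevant.\<close>

fun walsh :: "bool list \<Rightarrow> (nat \<Rightarrow> real) \<Rightarrow> real" where
  "walsh [] F = F 0"
| "walsh (b # s) F = walsh s (\<lambda>k. F k + (if b then - 1 else 1) * F (Suc k))"

fun avg :: "nat \<Rightarrow> (bool list \<Rightarrow> real) \<Rightarrow> real" where
  "avg 0 h = h []"
| "avg (Suc n) h = (avg n (\<lambda>s. h (False # s)) + avg n (\<lambda>s. h (True # s))) / 2"

text \<open>The factor \<open>2^n\<close> in \<open>walsh\<close> cancels against the mean over the
  \<open>2^n\<close> sets, so this is the spectral norm of the function with layer values
  \<open>F\<close>.\<close>

definition layer_norm :: "nat \<Rightarrow> (nat \<Rightarrow> real) \<Rightarrow> real" where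
  "layer_norm n F = avg n (\<lambda>s. \<bar>walsh s F\<bar>)"

lemma avg_mono:
  assumes "\<And>s. length s = n \<Longrightarrow> h s \<le> h' s"
  shows "avg n h \<le> avg n h'"
  using assms
proof (induction n arbitrary: h h')
  case (Suc n)
  have "avg n (\<lambda>s. h (b # s)) \<le> avg n (\<lambda>s. h' (b # s))" for b
    by (rule Suc.IH) (simp add: Suc.prems)
  from this[of False] this[of True] show ?case by simp
qed simp

lemma avg_cong:
  assumes "\<And>s. length s = n \<Longrightarrow> h s = h' s"
  shows "avg n h = avg n h'"
  using assms by (intro antisym avg_mono) auto

lemma avg_add: "avg n (\<lambda>s. h s + h' s) = avg n h + avg n h'"
  by (induction n arbitrary: h h') (simp_all add: field_simps)

lemma avg_mult: "avg n (\<lambda>s. a * h s) = a * avg n h"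
  by (induction n arbitrary: h) (simp_all add: field_simps)

lemma walsh_add: "walsh s (\<lambda>k. F k + G k) = walsh s F + walsh s G"
proof (induction s arbitrary: F G)
  case (Cons b s)
  have "walsh (b # s) (\<lambda>k. F k + G k) =
      walsh s (\<lambda>k. (F k + (if b then - 1 else 1) * F (Suc k)) +
                   (G k + (if b then - 1 else 1) * G (Suc k)))"
    by (simp add: algebra_simps)
  then show ?case by (simp only: Cons.IH walsh.simps)
qed simp

lemma walsh_mult: "walsh s (\<lambda>k. a * F k) = a * walsh s F"
proof (induction s arbitrary: F)
  case (Cons b s)
  have "walsh (b # s) (\<lambda>k. a * F k) =
      walsh s (\<lambda>k. a * (F k + (if b then - 1 else 1) * F (Suc k)))"
    by (simp add: algebra_simps)
  then show ?case by (simp only: Cons.IH walsh.simps)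
qed simp

lemma walsh_diff: "walsh s (\<lambda>k. F k - G k) = walsh s F - walsh s G"
  using walsh_add[of s F "\<lambda>k. -1 * G k"] unfolding walsh_mult by simp

lemma walsh_cong:
  assumes "\<And>k. k \<le> length s \<Longrightarrow> F k = G k"
  shows "walsh s F = walsh s G"
  using assms
proof (induction s arbitrary: F G)
  case (Cons b s)
  show ?case unfolding walsh.simps by (rule Cons.IH) (use Cons.prems in auto)
qed simp

lemma walsh_Cons:
  "walsh (b # s) F = walsh s F + (if b then - 1 else 1) * walsh s (\<lambda>k. F (Suc k))"
  by (simp only: walsh.simps walsh_add walsh_mult)

declare walsh.simps(2) [simp del]

text \<open>Complementing all coordinates multiplies each coefficient by a sign, the parity of the
  size of its set.\<close>

lemma walsh_reflect: "\<bar>walsh s (\<lambda>k. F (length s - k))\<bar> = \<bar>walsh s F\<bar>"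
proof (induction s arbitrary: F)
  case (Cons b s)
  have "walsh (b # s) (\<lambda>k. F (length (b # s) - k)) =
      walsh s (\<lambda>k. (if b then - 1 else 1) *
        (\<lambda>k. F k + (if b then - 1 else 1) * F (Suc k)) (length s - k))"
    unfolding walsh.simps by (rule walsh_cong) (auto simp: Suc_diff_le)
  then have "\<bar>walsh (b # s) (\<lambda>k. F (length (b # s) - k))\<bar> =
      \<bar>walsh s (\<lambda>k. (\<lambda>k. F k + (if b then - 1 else 1) * F (Suc k)) (length s - k))\<bar>"
    by (simp only: walsh_mult abs_mult) simp
  also have "\<dots> = \<bar>walsh (b # s) F\<bar>" unfolding walsh.simps by (rule Cons.IH)
  finally show ?case .
qed simp

lemma layer_norm_0 [simp]: "layer_norm 0 F = \<bar>F 0\<bar>"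
  by (simp add: layer_norm_def)

lemma layer_norm_Suc:
  "layer_norm (Suc n) F =
     (layer_norm n (\<lambda>k. F k + F (Suc k)) + layer_norm n (\<lambda>k. F k - F (Suc k))) / 2"
  by (simp add: layer_norm_def walsh.simps(2))

lemma layer_norm_mult: "layer_norm n (\<lambda>k. a * F k) = \<bar>a\<bar> * layer_norm n F"
  by (simp add: layer_norm_def walsh_mult abs_mult avg_mult)

lemma layer_norm_triangle: "layer_norm n (\<lambda>k. F k + G k) \<le> layer_norm n F + layer_norm n G"
  unfolding layer_norm_def avg_add[symmetric] by (rule avg_mono) (simp add: walsh_add)

lemma layer_norm_triangle_diff:
  "layer_norm n (\<lambda>k. F k - G k) \<le> layer_norm n F + layer_norm n G"
  unfolding layer_norm_def avg_add[symmetric] by (rule avg_mono) (simp add: walsh_diff)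

lemma layer_norm_nonneg: "0 \<le> layer_norm n F"
  using avg_mono[of n "\<lambda>s. 0 * 0" "\<lambda>s. \<bar>walsh s F\<bar>"] unfolding layer_norm_def avg_mult by simp

lemma layer_norm_reflect: "layer_norm n (\<lambda>k. F (n - k)) = layer_norm n F"
  unfolding layer_norm_def by (rule avg_cong) (use walsh_reflect in auto)

text \<open>Multiplication by parity moves each coefficient to the complementary set; in the
  recursion it swaps the two halves.\<close>

lemma layer_norm_alternate: "layer_norm n (\<lambda>k. F k * (- 1) ^ k) = layer_norm n F"
proof (induction n arbitrary: F)
  case (Suc n)
  show ?case
    using Suc.IH[of "\<lambda>k. F k + F (Suc k)"] Suc.IH[of "\<lambda>k. F k - F (Suc k)"]
    by (simp add: layer_norm_Suc algebra_simps)
qed simp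

lemma layer_norm_const: "layer_norm n (\<lambda>k. c) = \<bar>c\<bar>"
proof (induction n arbitrary: c)
  case (Suc n)
  show ?case using Suc.IH[of "c + c"] Suc.IH[of 0] by (simp add: layer_norm_Suc)
qed simp

text \<open>The two restrictions of a coordinate are half the sum and half the difference of
  \<open>?p\<close> and \<open>?m\<close>, the functions in \<open>layer_norm_Suc\<close>.\<close>

lemma
  shows layer_norm_restrict0: "layer_norm n F \<le> layer_norm (Suc n) F"
    and layer_norm_restrict1: "layer_norm n (\<lambda>k. F (Suc k)) \<le> layer_norm (Suc n) F"
proof -
  let ?p = "\<lambda>k. F k + F (Suc k)" and ?m = "\<lambda>k. F k - F (Suc k)"
  have "2 * layer_norm n F = layer_norm n (\<lambda>k. ?p k + ?m k)"
    using layer_norm_mult[of n 2 F] by (simp add: algebra_simps)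
  then show "layer_norm n F \<le> layer_norm (Suc n) F"
    using layer_norm_triangle[of n ?p ?m] by (simp add: layer_norm_Suc)
  have "2 * layer_norm n (\<lambda>k. F (Suc k)) = layer_norm n (\<lambda>k. ?p k - ?m k)"
    using layer_norm_mult[of n 2 "\<lambda>k. F (Suc k)"] by (simp add: algebra_simps)
  then show "layer_norm n (\<lambda>k. F (Suc k)) \<le> layer_norm (Suc n) F"
    using layer_norm_triangle_diff[of n ?p ?m] by (simp add: layer_norm_Suc)
qed

text \<open>Fixing \<open>a\<close> coordinates to 1 and \<open>n - a - m\<close> to 0 leaves
  \<open>m\<close> free ones, and no restriction increases the norm.\<close>

lemma layer_norm_window:
  assumes "a + m \<le> n"
  shows "layer_norm m (\<lambda>k. F (a + k)) \<le> layer_norm n F"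
proof -
  have "layer_norm m (\<lambda>k. F (a + k)) \<le> layer_norm (a + m) F"
  proof (induction a arbitrary: F)
    case (Suc a)
    show ?case using Suc.IH[of "\<lambda>k. F (Suc k)"] layer_norm_restrict1[of "a + m" F] by simp
  qed simp
  also have "layer_norm (a + m) F \<le> layer_norm n F"
    using assms by (induction n rule: dec_induct) (auto intro: order_trans layer_norm_restrict0)
  finally show ?thesis .
qed

section \<open>Binomial sums: point masses and Parseval\<close>

lemma sum_binomial_Suc:
  fixes g :: "nat \<Rightarrow> real"
  shows "(\<Sum>k\<le>Suc n. real (Suc n choose k) * g k) =
    (\<Sum>k\<le>n. real (n choose k) * g k) + (\<Sum>k\<le>n. real (n choose k) * g (Suc k))"
proof -
  have "(\<Sum>k\<le>Suc n. real (Suc n choose k) * g k) =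
      g 0 + (\<Sum>k\<le>n. real (n choose Suc k) * g (Suc k)) + (\<Sum>k\<le>n. real (n choose k) * g (Suc k))"
    by (subst sum.atMost_Suc_shift) (simp add: algebra_simps sum.distrib)
  also have "g 0 + (\<Sum>k\<le>n. real (n choose Suc k) * g (Suc k)) = (\<Sum>k\<le>Suc n. real (n choose k) * g k)"
    by (subst sum.atMost_Suc_shift) simp
  finally show ?thesis by (simp add: binomial_eq_0)
qed

text \<open>Layer \<open>k\<close> consists of \<open>n choose k\<close> points, and a point mass
  has spectral norm 1.\<close>

lemma layer_norm_le: "layer_norm n F \<le> (\<Sum>k\<le>n. real (n choose k) * \<bar>F k\<bar>)"
proof (induction n arbitrary: F)
  case (Suc n)
  have "layer_norm (Suc n) F \<le> layer_norm n F + layer_norm n (\<lambda>k. F (Suc k))"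
    using layer_norm_triangle[of n F "\<lambda>k. F (Suc k)"]
      layer_norm_triangle_diff[of n F "\<lambda>k. F (Suc k)"] by (simp add: layer_norm_Suc)
  also have "\<dots> \<le> (\<Sum>k\<le>n. real (n choose k) * \<bar>F k\<bar>) + (\<Sum>k\<le>n. real (n choose k) * \<bar>F (Suc k)\<bar>)"
    by (intro add_mono Suc.IH)
  also have "\<dots> = (\<Sum>k\<le>Suc n. real (Suc n choose k) * \<bar>F k\<bar>)"
    by (rule sum_binomial_Suc[symmetric])
  finally show ?case .
qed simp

text \<open>Parseval without normalisation: the right-hand side sums the squared values over the
  cube. The induction step is the parallelogram law.\<close>

lemma avg_walsh_square: "avg n (\<lambda>s. (walsh s F)\<^sup>2) = (\<Sum>k\<le>n. real (n choose k) * (F k)\<^sup>2)"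
proof (induction n arbitrary: F)
  case (Suc n)
  have "avg (Suc n) (\<lambda>s. (walsh s F)\<^sup>2) =
      (avg n (\<lambda>s. (walsh (False # s) F)\<^sup>2 + (walsh (True # s) F)\<^sup>2)) / 2"
    by (simp add: avg_add)
  also have "(\<lambda>s. (walsh (False # s) F)\<^sup>2 + (walsh (True # s) F)\<^sup>2) =
      (\<lambda>s. 2 * ((walsh s F)\<^sup>2 + (walsh s (\<lambda>k. F (Suc k)))\<^sup>2))"
    by (simp add: walsh_Cons power2_eq_square algebra_simps)
  finally show ?case
    by (simp add: avg_mult avg_add Suc.IH sum_binomial_Suc[of n "\<lambda>k. (F k)\<^sup>2"] del: sum.atMost_Suc)
qed simp

section \<open>Lower bounds by differences of spacing two\<close>

text \<open>Of the four sign patterns on two coordinates, the mixed ones both give \<open>?d\<close>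
  up to sign, and the equal ones, \<open>?p\<close> and \<open>?m\<close>, differ by four times the
  shifted profile.\<close>

lemma layer_norm_two_steps:
  "layer_norm n (\<lambda>k. F (Suc k)) + layer_norm n (\<lambda>k. F (k + 2) - F k) / 2 \<le> layer_norm (Suc (Suc n)) F"
proof -
  let ?p = "\<lambda>k. (F k + F (Suc k)) + (F (Suc k) + F (Suc (Suc k)))"
    and ?m = "\<lambda>k. (F k - F (Suc k)) - (F (Suc k) - F (Suc (Suc k)))"
    and ?d = "\<lambda>k. F (k + 2) - F k"
  have "4 * layer_norm n (\<lambda>k. F (Suc k)) = layer_norm n (\<lambda>k. ?p k - ?m k)"
    using layer_norm_mult[of n 4 "\<lambda>k. F (Suc k)"] by (simp add: algebra_simps)
  then have 1: "4 * layer_norm n (\<lambda>k. F (Suc k)) \<le> layer_norm n ?p + layer_norm n ?m"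
    using layer_norm_triangle_diff[of n ?p ?m] by simp
  have 2: "layer_norm n (\<lambda>k. (F k + F (Suc k)) - (F (Suc k) + F (Suc (Suc k)))) = layer_norm n ?d"
    "layer_norm n (\<lambda>k. (F k - F (Suc k)) + (F (Suc k) - F (Suc (Suc k)))) = layer_norm n ?d"
    using layer_norm_mult[of n "-1" ?d] by (simp_all add: algebra_simps)
  show ?thesis
    unfolding layer_norm_Suc[of "Suc n"] layer_norm_Suc[of n] 2 using 1 by (simp add: field_simps)
qed

definition step2 :: "(nat \<Rightarrow> real) \<Rightarrow> nat \<Rightarrow> real" where
  "step2 F k = F (k + 2) - F k"

lemma funpow_step2_shift: "(step2 ^^ d) (\<lambda>k. F (Suc k)) j = (step2 ^^ d) F (Suc j)"
  by (induction d arbitrary: j) (simp_all add: step2_def)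

text \<open>Each of the \<open>m\<close> pairs of coordinates either shifts the profile or takes a
  difference at the cost of a factor 1/2. Choosing \<open>d\<close> differences leaves
  \<open>m - d\<close> shifts, hence the evaluation point; Pascal's rule counts the choices.\<close>

lemma layer_norm_ge_step2:
  "real (m choose d) / 2 ^ d * \<bar>(step2 ^^ d) F (m - d)\<bar> \<le> layer_norm (2 * m) F"
proof (induction m arbitrary: d F)
  case 0
  show ?case by (cases d) auto
next
  case (Suc m)
  have two: "layer_norm (2 * m) (\<lambda>k. F (Suc k)) + layer_norm (2 * m) (step2 F) / 2
      \<le> layer_norm (2 * Suc m) F"
    using layer_norm_two_steps[of "2 * m" F] by (simp add: step2_def[abs_def])
  show ?case
  proof (cases d)
    case 0
    show ?thesis
      using Suc.IH[of 0 "\<lambda>k. F (Suc k)"] two layer_norm_nonneg[of "2 * m" "step2 F"] 0 by simp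
  next
    case (Suc e)
    have first: "real (m choose Suc e) / 2 ^ Suc e * \<bar>(step2 ^^ Suc e) F (m - e)\<bar> \<le>
        layer_norm (2 * m) (\<lambda>k. F (Suc k))"
    \<comment> \<open>For \<open>m < Suc e\<close> the index no longer matches the shift, but the
      binomial coefficient is 0.\<close>
    proof (cases "Suc e \<le> m")
      case True
      then have "Suc (m - Suc e) = m - e" by simp
      then show ?thesis
        using Suc.IH[of "Suc e" "\<lambda>k. F (Suc k)"] unfolding funpow_step2_shift by simp
    qed (simp add: layer_norm_nonneg binomial_eq_0)
    have second: "real (m choose e) / 2 ^ e * \<bar>(step2 ^^ Suc e) F (m - e)\<bar> \<le>
        layer_norm (2 * m) (step2 F)"
      using Suc.IH[of e "step2 F"] by (simp only: funpow_Suc_right o_apply)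
    have "real (Suc m choose d) / 2 ^ d * y =
        real (m choose Suc e) / 2 ^ Suc e * y + real (m choose e) / 2 ^ e * y / 2" for y
      by (simp add: Suc field_simps)
    moreover have "Suc m - d = m - e" by (simp add: Suc)
    moreover note order_trans[OF add_mono[OF first divide_right_mono[OF second zero_le_numeral]] two]
    ultimately show ?thesis by (simp only: Suc)
  qed
qed

section \<open>Forward differences and interpolation of sign sequences\<close>

text \<open>Sampling a profile on one parity class turns \<open>step2\<close> into this ordinary
  difference, to which Newton interpolation applies.\<close>

definition fwd :: "(nat \<Rightarrow> real) \<Rightarrow> nat \<Rightarrow> real" where
  "fwd u i = u (Suc i) - u i"

lemma funpow_step2_eq_fwd: "(step2 ^^ j) F (b + 2 * i) = (fwd ^^ j) (\<lambda>i. F (b + 2 * i)) i"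
proof (induction j arbitrary: i)
  case (Suc j)
  show ?case using Suc.IH[of i] Suc.IH[of "Suc i"] by (simp add: step2_def fwd_def)
qed simp

text \<open>Newton's forward difference formula: the binomial expansion of the \<open>i\<close>-th
  power of the shift, which is 1 + \<open>fwd\<close>.\<close>

lemma newton_forward: "u i = (\<Sum>j\<le>i. real (i choose j) * (fwd ^^ j) u 0)"
proof (induction i arbitrary: u)
  case (Suc i)
  have "(\<Sum>j\<le>Suc i. real (Suc i choose j) * (fwd ^^ j) u 0) =
      (\<Sum>j\<le>i. real (i choose j) * (fwd ^^ j) u 0) +
      (\<Sum>j\<le>i. real (i choose j) * (fwd ^^ j) (fwd u) 0)"
    unfolding sum_binomial_Suc funpow_Suc_right o_apply ..
  also have "\<dots> = u i + fwd u i" by (simp only: Suc.IH[symmetric])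
  finally show ?case by (simp add: fwd_def[of u i] del: sum.atMost_Suc)
qed simp

lemma funpow_fwd_zero:
  assumes "\<And>i. i \<le> m \<Longrightarrow> v i = 0"
  shows "(fwd ^^ m) v 0 = 0"
  using assms
proof (induction m arbitrary: v)
  case (Suc m)
  show ?case unfolding funpow_Suc_right o_apply
    by (rule Suc.IH) (simp add: fwd_def Suc.prems)
qed simp

text \<open>The witness is Newton's formula cut off at order \<open>d\<close>. For
  \<open>i < L\<close> the omitted terms vanish, being differences of the vanishing
  \<open>d\<close>-th difference.\<close>

lemma fwd_zero_imp_poly:
  assumes "0 < d" and zero: "\<And>i. i + d < L \<Longrightarrow> (fwd ^^ d) u i = 0"
  obtains p :: "real poly" where "degree p < d" "\<And>i. i < L \<Longrightarrow> u i = poly p (real i)"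
proof
  let ?p = "\<Sum>j<d. smult ((fwd ^^ j) u 0 / fact j) (\<Prod>t = 0..<j. [:- real t, 1:])"
  show "degree ?p < d"
  proof (rule degree_sum_less)
    fix j assume "j \<in> {..<d}"
    have "degree (\<Prod>t = 0..<j. [:- real t, 1:]) \<le> j"
      using degree_prod_sum_le[of "{0..<j}" "\<lambda>t. [:- real t, 1:]"] by simp
    then show "degree (smult ((fwd ^^ j) u 0 / fact j) (\<Prod>t = 0..<j. [:- real t, 1:])) < d"
      using \<open>j \<in> {..<d}\<close> le_trans[OF degree_smult_le] by fastforce
  qed (use assms in auto)
  fix i assume i: "i < L"
  have high: "(fwd ^^ j) u 0 = 0" if "d \<le> j" "j \<le> i" for j
  proof -
    have "(fwd ^^ (j - d)) ((fwd ^^ d) u) 0 = 0"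
      by (rule funpow_fwd_zero) (use that i in \<open>auto intro!: zero\<close>)
    then show ?thesis using that(1) by (metis comp_apply funpow_add le_add_diff_inverse2)
  qed
  have "u i = (\<Sum>j\<le>i. real (i choose j) * (fwd ^^ j) u 0)" by (rule newton_forward)
  also have "\<dots> = (\<Sum>j<d. real (i choose j) * (fwd ^^ j) u 0)"
    by (rule sum.mono_neutral_cong) (use high in auto)
  also have "\<dots> = poly ?p (real i)"
    by (simp add: poly_sum poly_prod binomial_gbinomial gbinomial_prod_rev mult.commute)
  finally show "u i = poly ?p (real i)" .
qed

text \<open>A polynomial \<open>p\<close> interpolating the signs has \<open>p\<^sup>2 - 1\<close> vanishing at more
  points than its degree, so \<open>p\<close> is constant.\<close>

lemma sign_sequence_const:
  assumes "0 < d" and sign: "\<And>i. i < 2 * d \<Longrightarrow> u i \<in> {-1, 1}"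
    and zero: "\<And>i. i < d \<Longrightarrow> (fwd ^^ d) u i = 0"
    and "i < 2 * d" "j < 2 * d"
  shows "u i = u j"
proof -
  obtain p :: "real poly" where p: "degree p < d" "\<And>i. i < 2 * d \<Longrightarrow> u i = poly p (real i)"
    using fwd_zero_imp_poly[of d "2 * d" u] assms by auto
  have "p * p = 1"
  proof (rule ccontr)
    assume "p * p \<noteq> 1"
    then have nz: "p * p - 1 \<noteq> 0" by simp
    have "real ` {..<2 * d} \<subseteq> {x. poly (p * p - 1) x = 0}"
    proof safe
      fix i assume "i < 2 * d"
      then show "poly (p * p - 1) (real i) = 0" using p(2)[of i] sign[of i] by auto
    qed
    then have "card (real ` {..<2 * d}) \<le> card {x. poly (p * p - 1) x = 0}"
      by (intro card_mono poly_roots_finite nz)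
    also have "\<dots> \<le> degree (p * p - 1)" by (rule card_poly_roots_bound[OF nz])
    also have "\<dots> \<le> degree p + degree p"
      by (rule degree_diff_le) (auto simp: degree_mult_le)
    finally show False using p(1) by (simp add: card_image inj_on_def)
  qed
  then have "degree p = 0"
    by (metis add_is_0 degree_1 degree_mult_eq mult_zero_left zero_neq_one)
  then obtain c where "p = [:c:]" by (rule degree_eq_zeroE)
  then show ?thesis using p(2) assms by simp
qed

section \<open>Exponential lower bound from a jump\<close>

text \<open>First differences of signs lie in {-2, 0, 2}, and higher ones are integer combinations
  of these. A nonzero difference thus has absolute value at least 2.\<close>

lemma step2_even:
  assumes "\<And>k. F k \<in> {-1, 1}" "0 < d"
  shows "\<exists>m::int. (step2 ^^ d) F k = 2 * of_int m"
  using assms(2)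
proof (induction d arbitrary: k rule: nat_induct_non_zero)
  case 1
  have "step2 F k \<in> {-2, 0, 2}" using assms(1)[of k] assms(1)[of "k + 2"] by (auto simp: step2_def)
  then show ?case
    using exI[of "\<lambda>m. step2 F k = 2 * of_int m" "-1"] exI[of "\<lambda>m. step2 F k = 2 * of_int m" 0]
      exI[of "\<lambda>m. step2 F k = 2 * of_int m" 1] by auto
next
  case (Suc d)
  obtain m m' where "(step2 ^^ d) F k = 2 * of_int m" "(step2 ^^ d) F (k + 2) = 2 * of_int m'"
    using Suc.IH by blast
  then have "(step2 ^^ Suc d) F k = 2 * of_int (m' - m)" by (simp add: step2_def)
  then show ?case by blast
qed

text \<open>\<open>layer_norm_ge_step2\<close> is applied to the window of
  \<open>2 * (k + d)\<close> coordinates starting at \<open>k0 - k\<close>, where \<open>k0\<close>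
  sits at the required position \<open>k\<close>.\<close>

lemma layer_norm_ge_of_step2_nonzero:
  assumes F: "\<And>k. F k \<in> {-1, 1}" and "0 < d" "k \<le> k0" "k0 + k + 2 * d \<le> n"
    and "(step2 ^^ d) F k0 \<noteq> 0"
  shows "2 * (real (k + d choose d) / 2 ^ d) \<le> layer_norm n F"
proof -
  obtain m where m: "(step2 ^^ d) F k0 = 2 * of_int m" using step2_even[of F d k0] F \<open>0 < d\<close> by blast
  with assms(5) have "1 \<le> \<bar>m\<bar>" by auto
  then have "1 \<le> \<bar>real_of_int m\<bar>" by linarith
  then have "2 \<le> \<bar>(step2 ^^ d) F k0\<bar>" by (simp add: m abs_mult)
  moreover have "(step2 ^^ d) (\<lambda>k. F (a + k)) j = (step2 ^^ d) F (a + j)" for a j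
    by (induction d arbitrary: j) (simp_all add: step2_def add.assoc)
  from this[of "k0 - k" k] have "(step2 ^^ d) (\<lambda>j. F (k0 - k + j)) k = (step2 ^^ d) F k0"
    using \<open>k \<le> k0\<close> by simp
  ultimately have "2 * (real (k + d choose d) / 2 ^ d) \<le>
      real (k + d choose d) / 2 ^ d * \<bar>(step2 ^^ d) (\<lambda>j. F (k0 - k + j)) (k + d - d)\<bar>"
    by (simp del: add_diff_assoc2 add_diff_assoc add: divide_right_mono mult.commute[of 2] mult_left_mono)
  also have "\<dots> \<le> layer_norm (2 * (k + d)) (\<lambda>j. F (k0 - k + j))" by (rule layer_norm_ge_step2)
  also have "\<dots> \<le> layer_norm n F" by (rule layer_norm_window) (use assms in auto)
  finally show ?thesis .
qed

lemma layer_norm_ge_exp: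
  assumes F: "\<And>k. F k \<in> {-1, 1}" and "2 \<le> r" "2 * r \<le> n" and jump: "F (r - 1) \<noteq> F (r + 1)"
  shows "2 powr (r / 7) \<le> layer_norm n F"
proof (cases "r < 7")
  case True
  have "(step2 ^^ 1) F (r - 1) \<noteq> 0" using jump assms(2) by (simp add: step2_def)
  then have "2 \<le> layer_norm n F"
    using layer_norm_ge_of_step2_nonzero[OF F, of 1 1 "r - 1" n] assms by simp
  moreover have "2 powr (r / 7) \<le> 2 powr 1" using True by (intro powr_mono) auto
  ultimately show ?thesis by simp
next
  case False
  \<comment> \<open>With \<open>7 * d \<le> r\<close>, all starting points \<open>b + 2 * i\<close>
    below exceed \<open>3 * d\<close>, so \<open>k = 3 * d\<close> fits into the window
    lemma.\<close>
  define d where "d = r div 7"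
  have d: "0 < d" "7 * d \<le> r" "r < 7 * d + 7" using False by (auto simp: d_def)
  \<comment> \<open>The last two of the \<open>2 * d\<close> samples \<open>b + 2 * i\<close> fall
    on \<open>r - 1\<close> and \<open>r + 1\<close>, so the jump contradicts constancy.\<close>
  define b where "b = r + 3 - 4 * d"
  have b: "b + 2 * (2 * d - 1) = r + 1" "b + 2 * (2 * d - 2) = r - 1" "b + 4 * d = r + 3"
    using d by (auto simp: b_def)
  have "\<exists>i<d. (fwd ^^ d) (\<lambda>i. F (b + 2 * i)) i \<noteq> 0"
  proof (rule ccontr)
    assume "\<not> ?thesis"
    then have "F (b + 2 * (2 * d - 2)) = F (b + 2 * (2 * d - 1))"
      using sign_sequence_const[of d "\<lambda>i. F (b + 2 * i)" "2 * d - 2" "2 * d - 1"] d F by auto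
    then show False using jump unfolding b by simp
  qed
  then obtain i where i: "i < d" "(step2 ^^ d) F (b + 2 * i) \<noteq> 0"
    by (auto simp: funpow_step2_eq_fwd)
  have "2 powr (r / 7) \<le> 2 powr (real d + 1)" using d by (intro powr_mono) auto
  also have "\<dots> = 2 * 2 ^ d" by (simp add: powr_add powr_realpow)
  also have "(2 :: real) ^ d = (real (3 * d + d) / real d) ^ d / 2 ^ d"
    using d by (simp add: power_divide[symmetric])
  also have "\<dots> \<le> real (3 * d + d choose d) / 2 ^ d"
    using binomial_ge_n_over_k_pow_k[of d "3 * d + d", where 'a = real]
    by (intro divide_right_mono) auto
  also have "2 * (real (3 * d + d choose d) / 2 ^ d) \<le> layer_norm n F"
    by (rule layer_norm_ge_of_step2_nonzero[OF F _ _ _ i(2)]) (use d b i assms in auto)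
  finally show ?thesis by simp
qed

section \<open>Hypercontractivity and functions supported on two tails\<close>

lemma avg_walsh_square_Suc:
  "avg (Suc n) (\<lambda>s. (walsh s F)\<^sup>2) =
     avg n (\<lambda>s. (walsh s F)\<^sup>2) + avg n (\<lambda>s. (walsh s (\<lambda>k. F (Suc k)))\<^sup>2)"
  unfolding avg_walsh_square by (rule sum_binomial_Suc)

text \<open>Bonami's inequality, in a two-function form whose induction needs no Cauchy-Schwarz:
  the cross term \<open>4 P\<^sub>0 P\<^sub>1 Q\<^sub>0 Q\<^sub>1\<close> is split by AM-GM, and each shift of a
  function lowers its degree and so pays for a factor \<open>3\<close>.\<close>

lemma bonami:
  assumes "\<And>k. a < k \<Longrightarrow> F k = 0" "\<And>k. b < k \<Longrightarrow> G k = 0"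
  shows "avg n (\<lambda>s. (walsh s F)\<^sup>2 * (walsh s G)\<^sup>2) \<le>
    3 ^ (a + b) * (avg n (\<lambda>s. (walsh s F)\<^sup>2) * avg n (\<lambda>s. (walsh s G)\<^sup>2))"
  using assms
proof (induction n arbitrary: F G a b)
  case 0
  have "1 * ((F 0)\<^sup>2 * (G 0)\<^sup>2) \<le> 3 ^ (a + b) * ((F 0)\<^sup>2 * (G 0)\<^sup>2)"
    by (intro mult_right_mono one_le_power) auto
  then show ?case by simp
next
  case (Suc n)
  define F' G' where "F' = (\<lambda>k. F (Suc k))" and "G' = (\<lambda>k. G (Suc k))"
  define M where "M = (\<lambda>H. avg n (\<lambda>s. (walsh s H)\<^sup>2))"
  define T where "T = (\<lambda>H K. avg n (\<lambda>s. (walsh s H)\<^sup>2 * (walsh s K)\<^sup>2))"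
  have M_nonneg: "0 \<le> M H" for H
    unfolding M_def avg_walsh_square by (intro sum_nonneg) auto
  have M0: "M (\<lambda>k. 0) = 0"
    by (simp add: M_def avg_walsh_square)
  have F': "F' k = 0" if "a - 1 < k" for k
    using Suc.prems(1)[of "Suc k"] that by (simp add: F'_def)
  have G': "G' k = 0" if "b - 1 < k" for k
    using Suc.prems(2)[of "Suc k"] that by (simp add: G'_def)
  \<comment> \<open>In degree 0 the subtraction \<open>c - 1\<close> is truncated, but then the
    shifted function is zero.\<close>
  have drop: "3 * (3 ^ (c - 1) * M H) \<le> 3 ^ c * M H" if "c = 0 \<Longrightarrow> H = (\<lambda>k. 0)" for c H
    using that by (cases c) (auto simp: M0)
  have dF: "3 * (3 ^ (a - 1) * M F') \<le> 3 ^ a * M F'"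
    by (rule drop) (use Suc.prems(1) in \<open>auto simp: F'_def\<close>)
  have dG: "3 * (3 ^ (b - 1) * M G') \<le> 3 ^ b * M G'"
    by (rule drop) (use Suc.prems(2) in \<open>auto simp: G'_def\<close>)
  let ?A = "3 ^ a * M F" and ?A' = "3 ^ a * M F'" and ?B = "3 ^ b * M G" and ?B' = "3 ^ b * M G'"
  have nn: "0 \<le> ?A" "0 \<le> ?A'" "0 \<le> ?B" "0 \<le> ?B'"
    using M_nonneg by auto
  have t1: "T F G \<le> ?A * ?B"
    using Suc.IH[of a F b G, OF Suc.prems] by (simp add: T_def M_def power_add mult_ac)
  have "T F' G \<le> (3 ^ (a - 1) * M F') * ?B"
    using Suc.IH[of "a - 1" F' b G, OF F' Suc.prems(2)] by (simp add: T_def M_def power_add mult_ac)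
  also have "\<dots> \<le> (?A' / 3) * ?B"
    by (intro mult_right_mono) (use dF nn in auto)
  finally have t2: "3 * T F' G \<le> ?A' * ?B" by simp
  have "T F G' \<le> ?A * (3 ^ (b - 1) * M G')"
    using Suc.IH[of a F "b - 1" G', OF Suc.prems(1) G'] by (simp add: T_def M_def power_add mult_ac)
  also have "\<dots> \<le> ?A * (?B' / 3)"
    by (intro mult_left_mono) (use dG nn in auto)
  finally have t3: "3 * T F G' \<le> ?A * ?B'" by simp
  have "T F' G' \<le> (3 ^ (a - 1) * M F') * (3 ^ (b - 1) * M G')"
    using Suc.IH[of "a - 1" F' "b - 1" G', OF F' G'] by (simp add: T_def M_def power_add mult_ac)
  also have "\<dots> \<le> ?A' * ?B'"
    using dF dG nn M_nonneg by (intro mult_mono) auto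
  finally have t4: "T F' G' \<le> ?A' * ?B'" .
  have pointwise: "((p + p')\<^sup>2 * (q + q')\<^sup>2 + (p - p')\<^sup>2 * (q - q')\<^sup>2) / 2 \<le>
      p\<^sup>2 * q\<^sup>2 + (3 * (p'\<^sup>2 * q\<^sup>2) + (3 * (p\<^sup>2 * q'\<^sup>2) + p'\<^sup>2 * q'\<^sup>2))" for p p' q q' :: real
    using zero_le_power2[of "p * q' - p' * q"] by (simp add: power2_eq_square algebra_simps)
  have "avg (Suc n) (\<lambda>s. (walsh s F)\<^sup>2 * (walsh s G)\<^sup>2) =
      avg n (\<lambda>s. (1/2) * ((walsh (False # s) F)\<^sup>2 * (walsh (False # s) G)\<^sup>2 +
        (walsh (True # s) F)\<^sup>2 * (walsh (True # s) G)\<^sup>2))"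
    by (simp only: avg_mult avg_add avg.simps)
  also have "\<dots> \<le> avg n (\<lambda>s. (walsh s F)\<^sup>2 * (walsh s G)\<^sup>2 +
      (3 * ((walsh s F')\<^sup>2 * (walsh s G)\<^sup>2) +
      (3 * ((walsh s F)\<^sup>2 * (walsh s G')\<^sup>2) + (walsh s F')\<^sup>2 * (walsh s G')\<^sup>2)))"
  proof (rule avg_mono)
    fix s :: "bool list"
    show "1 / 2 * ((walsh (False # s) F)\<^sup>2 * (walsh (False # s) G)\<^sup>2 +
        (walsh (True # s) F)\<^sup>2 * (walsh (True # s) G)\<^sup>2) \<le>
      (walsh s F)\<^sup>2 * (walsh s G)\<^sup>2 + (3 * ((walsh s F')\<^sup>2 * (walsh s G)\<^sup>2) +
      (3 * ((walsh s F)\<^sup>2 * (walsh s G')\<^sup>2) + (walsh s F')\<^sup>2 * (walsh s G')\<^sup>2))"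
      using pointwise[of "walsh s F" "walsh s F'" "walsh s G" "walsh s G'"]
      by (simp add: walsh_Cons F'_def G'_def)
  qed
  also have "\<dots> = T F G + (3 * T F' G + (3 * T F G' + T F' G'))"
    by (simp only: avg_add avg_mult T_def)
  also have "\<dots> \<le> (?A + ?A') * (?B + ?B')"
    using t1 t2 t3 t4 by (simp add: algebra_simps)
  also have "\<dots> = 3 ^ (a + b) * (avg (Suc n) (\<lambda>s. (walsh s F)\<^sup>2) * avg (Suc n) (\<lambda>s. (walsh s G)\<^sup>2))"
    unfolding avg_walsh_square_Suc M_def F'_def G'_def by (simp add: power_add algebra_simps)
  finally show ?case .
qed

text \<open>As a function of \<open>s\<close>, \<open>walsh s F\<close> has the Fourier coefficient
  \<open>F k\<close> at every set of size \<open>k\<close>, so its degree is at most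
  \<open>d\<close>; this is \<open>bonami\<close> with \<open>G = F\<close>.\<close>

lemma avg_walsh_power4:
  assumes "\<And>k. d < k \<Longrightarrow> F k = 0"
  shows "avg n (\<lambda>s. walsh s F ^ 4) \<le> 9 ^ d * (\<Sum>k\<le>n. real (n choose k) * (F k)\<^sup>2)\<^sup>2"
proof -
  define M where "M = (\<Sum>k\<le>n. real (n choose k) * (F k)\<^sup>2)"
  have "(3 :: real) ^ (d + d) = 9 ^ d"
    by (simp add: power_add power_mult_distrib[symmetric])
  moreover have "avg n (\<lambda>s. walsh s F ^ 4) = avg n (\<lambda>s. (walsh s F)\<^sup>2 * (walsh s F)\<^sup>2)"
    by (simp flip: power_add)
  ultimately show ?thesis
    using bonami[of d F d F n, OF assms assms]
    unfolding avg_walsh_square M_def[symmetric] power2_eq_square[of M] by simp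
qed

text \<open>\<open>P\<close> is the lower tail and \<open>Q\<close> the reflected upper tail. Both
  have degree at most \<open>d\<close>, and reflection affects \<open>walsh\<close> only by signs,
  which fourth powers ignore.\<close>

lemma avg_walsh_power4_two_tails:
  assumes "2 * d < n" and zero: "\<And>k. d < k \<Longrightarrow> k < n - d \<Longrightarrow> A k = 0"
  shows "avg n (\<lambda>s. walsh s A ^ 4) \<le> 8 * 9 ^ d * (\<Sum>k\<le>n. real (n choose k) * (A k)\<^sup>2)\<^sup>2"
proof -
  define P where "P = (\<lambda>k. if k \<le> d then A k else 0)"
  define Q where "Q = (\<lambda>k. if k \<le> d then A (n - k) else 0)"
  define M where "M = (\<lambda>F :: nat \<Rightarrow> real. \<Sum>k\<le>n. real (n choose k) * (F k)\<^sup>2)"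
  have M_nonneg: "0 \<le> M F" for F unfolding M_def by (intro sum_nonneg) auto
  have "M Q = M (\<lambda>k. Q (n - k))"
    unfolding M_def
    by (rule sum.reindex_bij_witness[of _ "\<lambda>k. n - k" "\<lambda>k. n - k"]) (auto simp: binomial_symmetric[symmetric])
  moreover have "M A = M P + M (\<lambda>k. Q (n - k))"
    unfolding M_def sum.distrib[symmetric]
    by (rule sum.cong) (use assms in \<open>auto simp: P_def Q_def\<close>)
  ultimately have M: "M A = M P + M Q" by simp
  have walsh: "walsh s A = walsh s P + walsh s (\<lambda>k. Q (n - k))" if "length s = n" for s
    unfolding walsh_add[symmetric]
    by (rule walsh_cong) (use assms that in \<open>auto simp: P_def Q_def\<close>)
  have quartic: "(p + q) ^ 4 \<le> 8 * (p ^ 4 + q ^ 4)" for p q :: real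
  proof -
    have "8 * (p ^ 4 + q ^ 4) - (p + q) ^ 4 = (p - q)\<^sup>2 * (5 * (p + q)\<^sup>2 + 2 * p\<^sup>2 + 2 * q\<^sup>2)"
      by (simp add: power2_eq_square power4_eq_xxxx algebra_simps)
    also have "0 \<le> \<dots>" by simp
    finally show ?thesis by simp
  qed
  have "avg n (\<lambda>s. walsh s A ^ 4) \<le> avg n (\<lambda>s. 8 * (walsh s P ^ 4 + walsh s Q ^ 4))"
  proof (rule avg_mono)
    fix s :: "bool list" assume s: "length s = n"
    have "\<bar>walsh s (\<lambda>k. Q (n - k))\<bar> ^ 4 = \<bar>walsh s Q\<bar> ^ 4"
      using walsh_reflect[of s Q] s by simp
    then have "walsh s (\<lambda>k. Q (n - k)) ^ 4 = walsh s Q ^ 4" by (simp add: power_even_abs)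
    then show "walsh s A ^ 4 \<le> 8 * (walsh s P ^ 4 + walsh s Q ^ 4)"
      using quartic[of "walsh s P" "walsh s (\<lambda>k. Q (n - k))"] walsh[OF s] by simp
  qed
  also have "\<dots> = 8 * (avg n (\<lambda>s. walsh s P ^ 4) + avg n (\<lambda>s. walsh s Q ^ 4))"
    by (simp add: avg_mult avg_add)
  also have "\<dots> \<le> 8 * (9 ^ d * (M P)\<^sup>2 + 9 ^ d * (M Q)\<^sup>2)"
    unfolding M_def
    by (intro mult_left_mono add_mono avg_walsh_power4) (auto simp: P_def Q_def)
  also have "\<dots> = 8 * 9 ^ d * ((M P)\<^sup>2 + (M Q)\<^sup>2)"
    by (simp add: algebra_simps)
  also have "\<dots> \<le> 8 * 9 ^ d * (M A)\<^sup>2"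
    using M_nonneg[of P] M_nonneg[of Q] unfolding M by (intro mult_left_mono) (auto simp: power2_sum)
  finally show ?thesis unfolding M_def .
qed

text \<open>The pointwise bound \<open>\<bar>u\<bar> \<ge> u\<^sup>2 / t - u\<^sup>4 / t\<^sup>3\<close>, averaged
  with \<open>t = 4 \<cdot> 3\<^sup>d \<cdot> sqrt M\<close>, turns the fourth-moment bound into a first-moment bound.\<close>

lemma layer_norm_two_tails:
  assumes "2 * d < n" "\<And>k. d < k \<Longrightarrow> k < n - d \<Longrightarrow> A k = 0"
    and m: "0 < m" "m\<^sup>2 \<le> (\<Sum>k\<le>n. real (n choose k) * (A k)\<^sup>2)"
  shows "m / (8 * 3 ^ d) \<le> layer_norm n A"
proof -
  define M where "M = (\<Sum>k\<le>n. real (n choose k) * (A k)\<^sup>2)"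
  have "0 < M" using m by (simp add: M_def) (meson less_le_trans zero_less_power)
  define r where "r = sqrt M"
  have r: "0 < r" "M = r\<^sup>2" "m \<le> r" using \<open>0 < M\<close> m by (auto simp: r_def M_def real_le_rsqrt)
  define t where "t = 4 * 3 ^ d * r"
  have "0 < t" using r by (simp add: t_def)
  have pointwise: "(1 / t) * u\<^sup>2 + (- 1 / t ^ 3) * u ^ 4 \<le> \<bar>u\<bar>" for u :: real
  proof -
    define v where "v = \<bar>u\<bar> / t"
    have v: "0 \<le> v" "\<bar>u\<bar> = t * v" using \<open>0 < t\<close> by (auto simp: v_def)
    have "v\<^sup>2 \<le> v + v ^ 4"
    proof (cases "v \<le> 1")
      case True
      then have "v * v \<le> 1 * v" using v by (intro mult_right_mono) auto
      then show ?thesis using v by (simp add: power2_eq_square add_increasing2)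
    next
      case False
      then have "v\<^sup>2 \<le> v ^ 4" by (intro power_increasing) auto
      then show ?thesis using v by simp
    qed
    then have "t * v\<^sup>2 \<le> t * (v + v ^ 4)" using \<open>0 < t\<close> by simp
    moreover have "u\<^sup>2 = (t * v)\<^sup>2" "u ^ 4 = (t * v) ^ 4"
      unfolding v(2)[symmetric] by (simp_all add: power_even_abs)
    then have "(1 / t) * u\<^sup>2 = t * v\<^sup>2" "(1 / t ^ 3) * u ^ 4 = t * v ^ 4"
      using \<open>0 < t\<close>
      by (simp_all add: field_simps power2_eq_square power3_eq_cube power4_eq_xxxx)
    ultimately show ?thesis using v by (simp add: algebra_simps)
  qed
  \<comment> \<open>This is what \<open>t\<close> is chosen for: the fourth-moment term costs only
    half of the main term \<open>M / t\<close>.\<close>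
  have "8 * 9 ^ d * M\<^sup>2 = t\<^sup>2 * M / 2"
    unfolding t_def r(2) by (simp add: power2_eq_square power_mult_distrib[symmetric])
  then have fourth: "avg n (\<lambda>s. walsh s A ^ 4) \<le> t\<^sup>2 * M / 2"
    using avg_walsh_power4_two_tails[of d n A] assms(1,2) unfolding M_def by simp
  have "m / (8 * 3 ^ d) \<le> r / (8 * 3 ^ d)" using r by (intro divide_right_mono) auto
  also have "\<dots> = M / (2 * t)" using r by (simp add: t_def power2_eq_square)
  also have "\<dots> = (1 / t) * M + (- 1 / t ^ 3) * (t\<^sup>2 * M / 2)"
    using \<open>0 < t\<close> by (simp add: field_simps power2_eq_square power3_eq_cube)
  also have "\<dots> \<le> (1 / t) * M + (- 1 / t ^ 3) * avg n (\<lambda>s. walsh s A ^ 4)"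
    using mult_left_mono[OF fourth, of "1 / t ^ 3"] \<open>0 < t\<close> by simp
  also have "\<dots> = avg n (\<lambda>s. (1 / t) * (walsh s A)\<^sup>2 + (- 1 / t ^ 3) * walsh s A ^ 4)"
    by (simp only: avg_add avg_mult avg_walsh_square M_def)
  also have "\<dots> \<le> layer_norm n A"
    unfolding layer_norm_def by (rule avg_mono) (rule pointwise)
  finally show ?thesis .
qed

section \<open>From the cube to layer profiles\<close>

lemma cube_Suc: "cube (Suc n) = (\<lambda>(b, x). x(Suc n := b)) ` ({0, 1} \<times> cube n)"
proof -
  have "{1..Suc n} = insert (Suc n) {1..n}" by auto
  then show ?thesis by (simp only: cube_def PiE_insert_eq)
qed

lemma cube_arbitrary: "x \<in> cube n \<Longrightarrow> Suc n \<notin> {1..n} \<Longrightarrow> x (Suc n) = undefined"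
  unfolding cube_def by (rule PiE_arb)

lemma sum_cube_Suc:
  fixes g :: "(nat \<Rightarrow> nat) \<Rightarrow> real"
  shows "(\<Sum>x\<in>cube (Suc n). g x) = (\<Sum>x\<in>cube n. g (x(Suc n := 0)) + g (x(Suc n := 1)))"
proof -
  have inj: "inj_on (\<lambda>(b, x). x(Suc n := b)) ({0, 1} \<times> cube n)"
  proof (rule inj_onI, clarify)
    fix b x b' x'
    assume x: "x \<in> cube n" "x' \<in> cube n" and eq: "x(Suc n := b) = x'(Suc n := b')"
    \<comment> \<open>Both points are \<open>undefined\<close> at the new coordinate, so the update
      can be undone.\<close>
    have "x (Suc n) = x' (Suc n)" using x by (simp add: cube_arbitrary)
    then show "b = b' \<and> x = x'"
      using eq by (metis fun_upd_same fun_upd_triv fun_upd_upd)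
  qed
  show ?thesis
    unfolding cube_Suc sum.reindex[OF inj]
    by (simp add: sum.cartesian_product' sum.distrib o_def)
qed

lemma card_cube: "card (cube n) = 2 ^ n"
  by (simp add: cube_def card_PiE numeral_2_eq_2)

lemma weight_upd: "weight (Suc n) (x(Suc n := b)) = weight n x + b"
  by (simp add: weight_def)

lemma chi_upd:
  assumes "S \<subseteq> {1..n}"
  shows "chi S (x(Suc n := b)) = chi S x"
    and "chi (insert (Suc n) S) (x(Suc n := b)) = (- 1) ^ b * chi S x"
proof -
  have "finite S" "Suc n \<notin> S" using assms finite_subset by auto
  moreover from this have "(\<Sum>i\<in>S. (x(Suc n := b)) i) = (\<Sum>i\<in>S. x i)"
    by (intro sum.cong) auto
  ultimately show "chi S (x(Suc n := b)) = chi S x"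
    and "chi (insert (Suc n) S) (x(Suc n := b)) = (- 1) ^ b * chi S x"
    by (simp_all add: chi_def power_add)
qed

lemma fourier_coeff_Suc:
  assumes "S \<subseteq> {1..n}"
  shows "fourier_coeff (Suc n) f S =
      fourier_coeff n (\<lambda>x. f (x(Suc n := 0)) + f (x(Suc n := 1))) S / 2"
    and "fourier_coeff (Suc n) f (insert (Suc n) S) =
      fourier_coeff n (\<lambda>x. f (x(Suc n := 0)) - f (x(Suc n := 1))) S / 2"
  unfolding fourier_coeff_def sum_cube_Suc
  by (simp_all add: chi_upd[OF assms] card_cube algebra_simps)

lemma spectral_norm_Suc:
  "spectral_norm (Suc n) f =
    (spectral_norm n (\<lambda>x. f (x(Suc n := 0)) + f (x(Suc n := 1))) +
     spectral_norm n (\<lambda>x. f (x(Suc n := 0)) - f (x(Suc n := 1)))) / 2"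
proof -
  have "{1..Suc n} = insert (Suc n) {1..n}" by auto
  then have Pow: "Pow {1..Suc n} = Pow {1..n} \<union> insert (Suc n) ` Pow {1..n}"
    by (simp only: Pow_insert)
  have inj: "inj_on (insert (Suc n)) (Pow {1..n})"
    by (rule inj_onI) (metis PowD atLeastAtMost_iff insert_ident not_less_eq_eq order_refl subsetD)
  have "spectral_norm (Suc n) f =
      (\<Sum>S\<in>Pow {1..n}. \<bar>fourier_coeff (Suc n) f S\<bar>) +
      (\<Sum>S\<in>Pow {1..n}. \<bar>fourier_coeff (Suc n) f (insert (Suc n) S)\<bar>)"
    unfolding spectral_norm_def Pow
    by (subst sum.union_disjoint) (auto simp: sum.reindex[OF inj, unfolded One_nat_def])
  then show ?thesis
    by (simp add: fourier_coeff_Suc spectral_norm_def add_divide_distrib sum_divide_distrib)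
qed

text \<open>\<open>spectral_norm_Suc\<close> and \<open>layer_norm_Suc\<close> are the same
  recursion: setting the last coordinate to \<open>b\<close> shifts the weight by
  \<open>b\<close>.\<close>

lemma spectral_norm_eq_layer_norm:
  assumes "\<And>x. x \<in> cube n \<Longrightarrow> f x = F (weight n x)"
  shows "spectral_norm n f = layer_norm n F"
  using assms
proof (induction n arbitrary: f F)
  case 0
  have "cube 0 = {\<lambda>_. undefined}" by (simp add: cube_def)
  then show ?case
    using 0[of "\<lambda>_. undefined"] by (simp add: spectral_norm_def fourier_coeff_def chi_def weight_def)
next
  case (Suc n)
  have f: "f (x(Suc n := b)) = F (weight n x + b)" if "x \<in> cube n" "b \<in> {0, 1}" for x b
  proof -
    have "x(Suc n := b) \<in> cube (Suc n)" using that unfolding cube_Suc by force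
    then show ?thesis by (simp only: Suc.prems weight_upd)
  qed
  have "spectral_norm n (\<lambda>x. f (x(Suc n := 0)) + f (x(Suc n := 1))) =
      layer_norm n (\<lambda>k. F k + F (Suc k))"
    by (rule Suc.IH) (use f[of _ 0] f[of _ 1] in \<open>simp add: fun_upd_def\<close>)
  moreover have "spectral_norm n (\<lambda>x. f (x(Suc n := 0)) - f (x(Suc n := 1))) =
      layer_norm n (\<lambda>k. F k - F (Suc k))"
    by (rule Suc.IH) (use f[of _ 0] f[of _ 1] in \<open>simp add: fun_upd_def\<close>)
  ultimately show ?case by (simp add: spectral_norm_Suc layer_norm_Suc)
qed

lemma weight_le: "x \<in> cube n \<Longrightarrow> weight n x \<le> n"
  unfolding weight_def cube_def
  using sum_bounded_above[of "{1..n}" x 1] by (force simp: PiE_iff)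

section \<open>Norm estimates for sign profiles\<close>

text \<open>Weighting the terms by powers of \<open>t = r / n\<close> and completing the sum gives
  \<open>(1 + t) ^ n\<close>, which is at most \<open>exp 1 ^ r\<close>.\<close>

lemma sum_binomial_le:
  assumes "0 < r" "r \<le> n"
  shows "(\<Sum>k<r. real (n choose k)) \<le> (exp 1 * (real n / real r)) ^ r"
proof -
  define t where "t = real r / real n"
  have t: "0 < t" "t \<le> 1" using assms by (auto simp: t_def)
  have "(\<Sum>k<r. real (n choose k)) * t ^ r = (\<Sum>k<r. real (n choose k) * t ^ r)"
    by (rule sum_distrib_right)
  also have "\<dots> \<le> (\<Sum>k<r. real (n choose k) * t ^ k)"
    by (intro sum_mono mult_left_mono power_decreasing) (use t in auto)
  also have "\<dots> \<le> (\<Sum>k\<le>n. real (n choose k) * t ^ k)"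
    by (rule sum_mono2) (use t assms in auto)
  also have "\<dots> = (t + 1) ^ n" by (subst binomial_ring) (simp add: mult.commute)
  also have "\<dots> \<le> exp t ^ n"
    using exp_ge_add_one_self[of t] t by (intro power_mono) (auto simp: add.commute)
  also have "\<dots> = exp 1 ^ r"
    using assms by (simp add: t_def exp_of_nat_mult[symmetric])
  finally have "(\<Sum>k<r. real (n choose k)) \<le> exp 1 ^ r / t ^ r"
    using t by (simp add: field_simps)
  also have "\<dots> = (exp 1 * (real n / real r)) ^ r"
    by (simp add: t_def power_mult_distrib power_divide)
  finally show ?thesis .
qed

lemma layer_norm_ge_1:
  assumes "\<And>k. F k \<in> {-1, 1}"
  shows "1 \<le> layer_norm n F"
  using layer_norm_window[of 0 0 n F] assms[of 0] by auto

text \<open>The factor 4 counts two tails of equal binomial mass, each with deviations from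
  \<open>c\<close> of size at most 2.\<close>

lemma layer_norm_le_binomial_sum:
  assumes "2 * r \<le> n" and F: "\<And>k. F k \<in> {-1, 1}" and c: "\<bar>c\<bar> = 1"
    and const: "\<And>k. r \<le> k \<Longrightarrow> k \<le> n - r \<Longrightarrow> F k = c"
  shows "layer_norm n F \<le> 1 + 4 * (\<Sum>k<r. real (n choose k))"
proof -
  let ?tails = "{k. k \<le> n \<and> (k < r \<or> n - r < k)}"
  have "layer_norm n F \<le> layer_norm n (\<lambda>k. c) + layer_norm n (\<lambda>k. F k - c)"
    using layer_norm_triangle[of n "\<lambda>k. c" "\<lambda>k. F k - c"] by simp
  also have "\<dots> \<le> 1 + (\<Sum>k\<le>n. real (n choose k) * \<bar>F k - c\<bar>)"
    using layer_norm_le[of n "\<lambda>k. F k - c"] c by (simp add: layer_norm_const)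
  also have "(\<Sum>k\<le>n. real (n choose k) * \<bar>F k - c\<bar>) = (\<Sum>k\<in>?tails. real (n choose k) * \<bar>F k - c\<bar>)"
    by (rule sum.mono_neutral_right) (use const not_le in auto)
  also have "\<dots> \<le> (\<Sum>k\<in>?tails. real (n choose k) * 2)"
  proof (intro sum_mono mult_left_mono)
    show "\<bar>F k - c\<bar> \<le> 2" for k using F[of k] c by auto
  qed simp
  also have "?tails = {..<r} \<union> {n - r<..n}" using assms(1) by auto
  also have "(\<Sum>k\<in>\<dots>. real (n choose k) * 2) =
      (\<Sum>k<r. real (n choose k) * 2) + (\<Sum>k\<in>{n - r<..n}. real (n choose k) * 2)"
    by (rule sum.union_disjoint) (use assms(1) in auto)
  also have "(\<Sum>k\<in>{n - r<..n}. real (n choose k) * 2) = (\<Sum>k<r. real (n choose k) * 2)"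
    by (rule sum.reindex_bij_witness[of _ "\<lambda>k. n - k" "\<lambda>k. n - k"])
      (use assms(1) in \<open>auto simp: binomial_symmetric[symmetric]\<close>)
  finally show ?thesis by (simp add: sum_distrib_right[symmetric])
qed

lemma layer_norm_le_two_power:
  assumes "\<And>k. F k \<in> {-1, 1}"
  shows "layer_norm n F \<le> 2 ^ n"
proof -
  have "\<bar>F k\<bar> = 1" for k using assms[of k] by auto
  moreover have "(\<Sum>k\<le>n. real (n choose k)) = 2 ^ n"
    using choose_row_sum[of n] by (metis of_nat_numeral of_nat_power of_nat_sum)
  ultimately show ?thesis using layer_norm_le[of n F] by simp
qed

text \<open>\<open>F - c\<close> lives on the two tails and equals 2 or -2 on layer \<open>d\<close>
  or \<open>n - d\<close>, so its Parseval sum is at least \<open>4 * (n choose d)\<close>. Removing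
  the constant costs 1.\<close>

lemma layer_norm_ge_binomial:
  assumes "2 * Suc d \<le> n" and F: "\<And>k. F k \<in> {-1, 1}" and c: "\<bar>c\<bar> = 1"
    and const: "\<And>k. Suc d \<le> k \<Longrightarrow> k \<le> n - Suc d \<Longrightarrow> F k = c"
    and ends: "F d \<noteq> c \<or> F (n - d) \<noteq> c"
  shows "sqrt (real (n choose d)) / (4 * 3 ^ d) - 1 \<le> layer_norm n F"
proof -
  let ?A = "\<lambda>k. F k - c"
  obtain k where k: "k = d \<or> k = n - d" "F k \<noteq> c" using ends by auto
  have "(2 * sqrt (real (n choose d)))\<^sup>2 = real (n choose k) * (?A k)\<^sup>2"
    using k F[of k] c assms(1) by (auto simp: power_mult_distrib binomial_symmetric[symmetric] abs_if split: if_splits)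
  also have "\<dots> \<le> (\<Sum>k\<le>n. real (n choose k) * (?A k)\<^sup>2)"
    by (rule member_le_sum) (use k assms(1) in auto)
  finally have "2 * sqrt (real (n choose d)) / (8 * 3 ^ d) \<le> layer_norm n ?A"
    by (intro layer_norm_two_tails) (use assms(1) const in auto)
  also have "\<dots> \<le> layer_norm n F + 1"
    using layer_norm_triangle_diff[of n F "\<lambda>k. c"] c by (simp add: layer_norm_const)
  finally show ?thesis by simp
qed

section \<open>Layer profiles and the meaning of \<open>r_of\<close>\<close>

lemma symmetric_fun_profile:
  assumes "sign_valued n f" "symmetric_fun n f"
  obtains F where "\<And>k. F k \<in> {-1, 1}" "\<And>x. x \<in> cube n \<Longrightarrow> f x = F (weight n x)"
proof -
  have "\<forall>k. \<exists>x. k \<le> n \<longrightarrow> x \<in> cube n \<and> weight n x = k"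
    using layer_nonempty by blast
  then obtain pt where pt: "\<And>k. k \<le> n \<Longrightarrow> pt k \<in> cube n" "\<And>k. k \<le> n \<Longrightarrow> weight n (pt k) = k"
    by metis
  \<comment> \<open>The default 1 above \<open>n\<close> keeps \<open>F\<close> sign-valued
    everywhere.\<close>
  define F where "F = (\<lambda>k. if k \<le> n then f (pt k) else 1)"
  have "F k \<in> {-1, 1}" for k
    using assms(1) pt(1)[of k] by (auto simp: sign_valued_def F_def)
  moreover have "f x = F (weight n x)" if x: "x \<in> cube n" for x
  proof -
    note le = weight_le[OF x]
    have "f x = f (pt (weight n x))"
      using assms(2) x pt(1)[OF le] pt(2)[OF le, symmetric] unfolding symmetric_fun_def by blast
    then show ?thesis using le by (simp add: F_def)
  qed
  ultimately show thesis by (rule that)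
qed

lemma constant_on_layers_profile:
  assumes "\<And>x. x \<in> cube n \<Longrightarrow> g x = G (weight n x)"
  shows "constant_on_layers n g K \<longleftrightarrow> (\<exists>c. \<forall>k\<in>K. k \<le> n \<longrightarrow> G k = c)"
proof
  assume "constant_on_layers n g K"
  then obtain c where c: "\<And>x. x \<in> cube n \<Longrightarrow> weight n x \<in> K \<Longrightarrow> g x = c"
    unfolding constant_on_layers_def by blast
  have "G k = c" if k: "k \<in> K" "k \<le> n" for k
  proof -
    obtain x where "x \<in> cube n" "weight n x = k" using layer_nonempty[OF k(2)] by blast
    then show ?thesis using assms[of x] c[of x] k(1) by simp
  qed
  then show "\<exists>c. \<forall>k\<in>K. k \<le> n \<longrightarrow> G k = c" by blast
next
  assume "\<exists>c. \<forall>k\<in>K. k \<le> n \<longrightarrow> G k = c"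
  then obtain c where c: "\<And>k. k \<in> K \<Longrightarrow> k \<le> n \<Longrightarrow> G k = c" by blast
  have "g x = c" if "x \<in> cube n" "weight n x \<in> K" for x
    using assms[OF that(1)] c[OF that(2) weight_le[OF that(1)]] by (rule trans)
  then show "constant_on_layers n g K" unfolding constant_on_layers_def by blast
qed

text \<open>The second alternative is the case without admissible interval.\<close>

lemma spectral_norm_profile:
  assumes "1 \<le> n" and f: "sign_valued n f" "symmetric_fun n f" and r: "r = r_of n f"
  obtains F c where "\<And>k. F k \<in> {-1, 1}" "spectral_norm n f = layer_norm n F" "\<bar>c\<bar> = 1"
    "2 * r < n" "\<And>k. r \<le> k \<Longrightarrow> k \<le> n - r \<Longrightarrow> F k = c"
    "0 < r \<Longrightarrow> F (r - 1) \<noteq> c \<or> F (n - (r - 1)) \<noteq> c"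
  | F where "\<And>k. F k \<in> {-1, 1}" "spectral_norm n f = layer_norm n F" "0 < r" "n = 2 * r"
    "F (r - 1) \<noteq> F (r + 1)"
proof (cases "\<exists>a b. admissible n f a b")
  case True
  note conclude = that(1)
  obtain F0 where F0: "\<And>k. F0 k \<in> {-1, 1}" "\<And>x. x \<in> cube n \<Longrightarrow> f x = F0 (weight n x)"
    using symmetric_fun_profile[OF f] by blast
  have "admissible n f (r0 n f) (r1 n f)"
    and min: "\<And>a b. admissible n f a b \<Longrightarrow> r0 n f \<le> a" "\<And>a b. admissible n f a b \<Longrightarrow> r1 n f \<le> b"
    using admissible_r0_r1[OF f(1)] True by blast+
  then have lt: "2 * r0 n f < n" "2 * r1 n f < n"
    and cases: "constant_on_layers n f {r0 n f..n - r1 n f} \<or>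
      constant_on_layers n (\<lambda>x. f x * parity n x) {r0 n f..n - r1 n f}"
    by (auto simp: admissible_def)
  have rmax: "r = max (r0 n f) (r1 n f)" using True by (simp add: r r_of_def)
  \<comment> \<open>Here \<open>g\<close> stands for \<open>f\<close> or for \<open>f\<close> times
    parity, and \<open>F\<close> for its profile.\<close>
  have main: thesis
    if F: "\<And>k. F k \<in> {-1, 1}" "layer_norm n F = layer_norm n F0"
      "\<And>x. x \<in> cube n \<Longrightarrow> g x = F (weight n x)"
      and const: "constant_on_layers n g {r0 n f..n - r1 n f}"
      and adm: "\<And>a b. \<lbrakk>2 * a < n; 2 * b < n; constant_on_layers n g {a..n - b}\<rbrakk> \<Longrightarrow> admissible n f a b"
    for F g
  proof -
    have layers: "constant_on_layers n g K \<longleftrightarrow> (\<exists>c. \<forall>k\<in>K. k \<le> n \<longrightarrow> F k = c)" for K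
      by (rule constant_on_layers_profile) (rule F(3))
    obtain c where "\<forall>k\<in>{r0 n f..n - r1 n f}. k \<le> n \<longrightarrow> F k = c"
      using const unfolding layers by blast
    then have c: "F k = c" if "r0 n f \<le> k" "k \<le> n - r1 n f" for k
      using that by simp
    have "F r = c" by (rule c) (use lt rmax in auto)
    then have "\<bar>c\<bar> = 1" using F(1)[of r] by auto
    \<comment> \<open>If both values were \<open>c\<close>, the constant interval could be extended
      on the side where \<open>r\<close> is attained, against the minimality of \<open>r0\<close> or
      \<open>r1\<close>.\<close>
    moreover have "F (r - 1) \<noteq> c \<or> F (n - (r - 1)) \<noteq> c" if "0 < r"
    proof (rule ccontr)
      assume "\<not> ?thesis"
      then have eq: "F (r - 1) = c" "F (n - (r - 1)) = c" by auto
      show False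
      proof (cases "r = r0 n f")
        case True
        have "F k = c" if "k \<in> {r - 1..n - r1 n f}" for k
          using that eq(1) c[of k] True by (cases "k = r - 1") auto
        then have "constant_on_layers n g {r - 1..n - r1 n f}" unfolding layers by auto
        then have "admissible n f (r - 1) (r1 n f)" by (intro adm) (use lt True in auto)
        from min(1)[OF this] show False using True \<open>0 < r\<close> by simp
      next
        case False
        then have r1: "r = r1 n f" using rmax by (simp add: max_def split: if_splits)
        have "F k = c" if "k \<in> {r0 n f..n - (r - 1)}" for k
          using that eq(2) c[of k] r1 by (cases "k = n - (r - 1)") auto
        then have "constant_on_layers n g {r0 n f..n - (r - 1)}" unfolding layers by auto
        then have "admissible n f (r0 n f) (r - 1)" by (intro adm) (use lt r1 in auto)
        from min(2)[OF this] show False using r1 \<open>0 < r\<close> by simp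
      qed
    qed
    moreover have "spectral_norm n f = layer_norm n F"
      unfolding F(2) by (rule spectral_norm_eq_layer_norm) (rule F0(2))
    moreover have "2 * r < n" using lt rmax by auto
    moreover have "F k = c" if "r \<le> k" "k \<le> n - r" for k
      by (rule c) (use that rmax in auto)
    ultimately show thesis by (intro conclude[of F c]) (use F(1) in auto)
  qed
  show thesis
    using cases
  proof
    assume "constant_on_layers n f {r0 n f..n - r1 n f}"
    then show thesis by (rule main[of F0, rotated 3]) (use F0 in \<open>auto simp: admissible_def\<close>)
  next
    let ?F = "\<lambda>k. F0 k * (- 1) ^ k"
    assume "constant_on_layers n (\<lambda>x. f x * parity n x) {r0 n f..n - r1 n f}"
    then show thesis
    proof (rule main[of ?F, rotated 3])
      show "?F k \<in> {-1, 1}" for k using F0(1)[of k] by (cases "even k") auto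
    qed (use F0 in \<open>auto simp: admissible_def layer_norm_alternate parity_weight\<close>)
  qed
next
  case False
  obtain F where F: "\<And>k. F k \<in> {-1, 1}" "\<And>x. x \<in> cube n \<Longrightarrow> f x = F (weight n x)"
    using symmetric_fun_profile[OF f] by blast
  have "even n" using admissible_exists_odd[OF f] False by blast
  moreover have "r = n div 2" using False by (simp add: r r_of_def)
  ultimately have n: "n = 2 * r" "0 < r" using assms(1) by auto
  \<comment> \<open>If the outer two of the three middle layers agreed, \<open>f\<close> would be
    constant or alternating on all three, and \<open>r - 1\<close> would be admissible on both
    sides.\<close>
  have "F (r - 1) \<noteq> F (r + 1)"
  proof
    assume eq: "F (r - 1) = F (r + 1)"
    have window: "k = r - 1 \<or> k = r \<or> k = r + 1" if "k \<in> {r - 1..n - (r - 1)}" for k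
      using that n by auto
    have "admissible n f (r - 1) (r - 1)"
    proof (cases "F r = F (r - 1)")
      case True
      have "F k = F r" if "k \<in> {r - 1..n - (r - 1)}" for k
        using window[OF that] eq True by auto
      then have "constant_on_layers n f {r - 1..n - (r - 1)}"
        using F(2) constant_on_layers_profile[of n f F] by auto
      then show ?thesis using n by (simp add: admissible_def)
    next
      case False
      then have opp: "F r = - F (r - 1)" using F(1)[of r] F(1)[of "r - 1"] by auto
      have "F k * (- 1) ^ k = F r * (- 1) ^ r" if "k \<in> {r - 1..n - (r - 1)}" for k
        using window[OF that] eq opp n(2) by (cases r) auto
      then have "constant_on_layers n (\<lambda>x. f x * parity n x) {r - 1..n - (r - 1)}"
        using F(2) constant_on_layers_profile[of n "\<lambda>x. f x * parity n x" "\<lambda>k. F k * (- 1) ^ k"]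
        by (auto simp: parity_weight)
      then show ?thesis using n by (simp add: admissible_def)
    qed
    then show False using False by blast
  qed
  moreover have "spectral_norm n f = layer_norm n F"
    by (rule spectral_norm_eq_layer_norm) (rule F(2))
  ultimately show thesis by (intro that(2)[of F]) (use F(1) n in auto)
qed

section \<open>Bounds on the spectral norm in terms of \<open>r\<close>\<close>

lemma log_bounds_of_power:
  fixes q N :: real
  assumes "1 < q" "1 \<le> N" "N \<le> q ^ k"
  shows "log 2 N \<le> real k * log 2 q"
  using assms log_le_cancel_iff[of 2 N "q ^ k"] by (simp add: log_nat_power)

text \<open>With \<open>q = n / r \<ge> 2\<close>, the factor \<open>exp 1\<close> is absorbed by
  \<open>q\<^sup>2\<close>, and since \<open>q ^ 3 \<ge> 8\<close> doubling the exponent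
  \<open>3 * r\<close> absorbs the remaining constants.\<close>

lemma spectral_norm_upper:
  assumes "1 \<le> n" "sign_valued n f" "symmetric_fun n f" and r: "r = r_of n f" "0 < r"
  shows "spectral_norm n f \<le> (real n / real r) ^ (6 * r)"
  using assms(1-3) r(1)
proof (cases rule: spectral_norm_profile)
  case (1 F c)
  define q where "q = real n / real r"
  have q: "2 \<le> q" using \<open>2 * r < n\<close> r by (simp add: q_def field_simps)
  then have q2: "4 \<le> q\<^sup>2" using power_mono[of 2 q 2] by simp
  have q3: "8 \<le> q ^ 3" using power_mono[of 2 q 3] q by simp
  have "spectral_norm n f \<le> 1 + 4 * (\<Sum>k<r. real (n choose k))"
    unfolding 1(2) by (rule layer_norm_le_binomial_sum[OF _ 1(1,3,5)]) (use 1(4) in auto)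
  also have "\<dots> \<le> 1 + 4 * (exp 1 * q) ^ r"
    using sum_binomial_le[of r n] 1(4) r by (simp add: q_def)
  also have "\<dots> \<le> 1 + 4 * (q ^ 3) ^ r"
  proof -
    have "exp 1 * q \<le> q\<^sup>2 * q"
      using exp_le q q2 by (intro mult_right_mono) auto
    then show ?thesis using q by (auto intro!: power_mono simp: power3_eq_cube power2_eq_square)
  qed
  also have "\<dots> \<le> (q ^ 3) ^ r * (q ^ 3) ^ r"
  proof -
    have "q ^ 3 \<le> (q ^ 3) ^ r" using q3 r by (intro self_le_power) auto
    then have "8 \<le> (q ^ 3) ^ r" using q3 by simp
    then have "8 * (q ^ 3) ^ r \<le> (q ^ 3) ^ r * (q ^ 3) ^ r" by (intro mult_right_mono) auto
    then show ?thesis using \<open>8 \<le> (q ^ 3) ^ r\<close> by linarith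
  qed
  also have "\<dots> = q ^ (6 * r)" by (simp flip: power_mult power_add)
  finally show ?thesis by (simp add: q_def)
next
  case (2 F)
  have "spectral_norm n f \<le> 2 ^ n" unfolding 2(2) by (rule layer_norm_le_two_power) (rule 2(1))
  also have "\<dots> \<le> (2 :: real) ^ (6 * r)" using \<open>n = 2 * r\<close> by (intro power_increasing) auto
  also have "2 = real n / real r" using 2(3,4) by simp
  finally show ?thesis .
qed

text \<open>Since \<open>2 * r < n\<close> in the first case, layers \<open>r + 1\<close> and
  \<open>n - (r + 1)\<close> carry \<open>c\<close>, so a deviation at \<open>r - 1\<close> or at
  its mirror image is a jump.\<close>

lemma spectral_norm_lower_exp:
  assumes "1 \<le> n" "sign_valued n f" "symmetric_fun n f" and r: "r = r_of n f" "2 \<le> r"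
  shows "2 powr (r / 7) \<le> spectral_norm n f"
  using assms(1-3) r(1)
proof (cases rule: spectral_norm_profile)
  case (1 F c)
  have mid: "F (r + 1) = c" "F (n - (r + 1)) = c"
    using 1(5)[of "r + 1"] 1(5)[of "n - (r + 1)"] \<open>2 * r < n\<close> by auto
  consider "F (r - 1) \<noteq> c" | "F (n - (r - 1)) \<noteq> c" using 1(6) r by auto
  then have "2 powr (r / 7) \<le> layer_norm n F"
  proof cases
    case first: 1
    show ?thesis by (rule layer_norm_ge_exp) (use first mid r 1(1,4) in simp_all)
  next
    case last: 2
    have "2 powr (r / 7) \<le> layer_norm n (\<lambda>k. F (n - k))"
      by (rule layer_norm_ge_exp) (use last mid r 1(1,4) in simp_all)
    then show ?thesis by (simp only: layer_norm_reflect)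
  qed
  then show ?thesis using 1(2) by simp
next
  case (2 F)
  show ?thesis unfolding 2(2) by (rule layer_norm_ge_exp[OF 2(1)]) (use 2(4,5) r in auto)
qed

lemma spectral_norm_lower_log:
  assumes "1 \<le> n" "sign_valued n f" "symmetric_fun n f" and r: "r = r_of n f" "2 \<le> r"
    and q: "331776 \<le> real n / real r"
  shows "real r / 8 * log 2 (real n / real r) \<le> log 2 (spectral_norm n f)"
  using assms(1-3) r(1)
proof (cases rule: spectral_norm_profile)
  case (1 F c)
  define d where "d = r - 1"
  have d: "0 < d" "r = Suc d" using r by (auto simp: d_def)
  \<comment> \<open>One square root comes from \<open>layer_norm_ge_binomial\<close>; half of the
    remaining exponent pays for \<open>3 ^ d\<close> and the constants. As 331776 is the fourth
    power of 24, \<open>Q \<ge> 24\<close> and \<open>8 * Q \<le> Q\<^sup>2 / 3\<close>.\<close>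
  define Q where "Q = sqrt (sqrt (real n / real d))"
  have "Q ^ 4 = (Q\<^sup>2)\<^sup>2" by (simp flip: power_mult)
  then have Q4: "Q ^ 4 = real n / real d" by (simp add: Q_def)
  have nr: "real n / real r \<le> real n / real d" using d by (intro divide_left_mono) auto
  have "24 \<le> Q"
    unfolding Q_def using q nr by (intro real_le_rsqrt) simp
  have "Q ^ d * 1 \<le> 2 * Q ^ d - 1" using one_le_power[of Q d] \<open>24 \<le> Q\<close> by simp
  also have "2 * Q ^ d \<le> 8 ^ d * Q ^ d / 4"
    using self_le_power[of "8 :: real" d] d \<open>24 \<le> Q\<close> by simp
  also have "8 ^ d * Q ^ d / 4 \<le> (Q\<^sup>2 / 3) ^ d / 4"
    unfolding power_mult_distrib[symmetric]
    using \<open>24 \<le> Q\<close> by (intro divide_right_mono power_mono) (auto simp: power2_eq_square)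
  also have "(Q\<^sup>2 / 3) ^ d / 4 = sqrt ((real n / real d) ^ d) / (4 * 3 ^ d)"
    unfolding real_sqrt_power power_divide[of "Q\<^sup>2"] by (simp add: Q_def)
  also have "\<dots> \<le> sqrt (real (n choose d)) / (4 * 3 ^ d)"
    using binomial_ge_n_over_k_pow_k[of d n, where 'a = real] \<open>2 * r < n\<close> d
    by (intro divide_right_mono real_sqrt_le_mono) auto
  also have "\<dots> - 1 \<le> spectral_norm n f"
    unfolding 1(2) by (rule layer_norm_ge_binomial[of d n F c]) (use 1 d in simp_all)
  finally have "Q ^ d \<le> spectral_norm n f" by simp
  then have "log 2 (Q ^ d) \<le> log 2 (spectral_norm n f)"
    using \<open>24 \<le> Q\<close> by (subst log_le_cancel_iff) (auto intro: less_le_trans[of 0 "Q ^ d"])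
  then have "real d * log 2 Q \<le> log 2 (spectral_norm n f)"
    using \<open>24 \<le> Q\<close> by (simp add: log_nat_power)
  moreover have "log 2 (real n / real r) \<le> log 2 (Q ^ 4)"
    unfolding Q4 using nr q by (subst log_le_cancel_iff) auto
  then have "log 2 (real n / real r) \<le> 4 * log 2 Q"
    using \<open>24 \<le> Q\<close> by (simp add: log_nat_power)
  then have "real r / 8 * log 2 (real n / real r) \<le> real r / 8 * (4 * log 2 Q)"
    by (intro mult_left_mono) auto
  \<comment> \<open>The loss \<open>d = r - 1 \<ge> r / 2\<close> and the fourth root together give
    1/8.\<close>
  moreover have "real r / 8 * (4 * log 2 Q) \<le> real d * log 2 Q"
    using d \<open>24 \<le> Q\<close> mult_right_mono[of "real r / 2" "real d" "log 2 Q"] by simp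
  ultimately show ?thesis by linarith
next
  case (2 F)
  from 2(3,4) show ?thesis using q by simp
qed

lemma spectral_norm_ge_1:
  assumes "sign_valued n f" "symmetric_fun n f"
  shows "1 \<le> spectral_norm n f"
proof -
  obtain F where F: "\<And>k. F k \<in> {-1, 1}" "\<And>x. x \<in> cube n \<Longrightarrow> f x = F (weight n x)"
    using symmetric_fun_profile[OF assms] by blast
  have "spectral_norm n f = layer_norm n F"
    by (rule spectral_norm_eq_layer_norm) (rule F(2))
  then show ?thesis using layer_norm_ge_1[of F n] F(1) by simp
qed

text \<open>At most layers 0 and \<open>n\<close> deviate from the constant, giving 1 + 4; without
  an admissible interval \<open>n = 2\<close>, and the norm is at most 4.\<close>

lemma spectral_norm_le_5:
  assumes "1 \<le> n" "sign_valued n f" "symmetric_fun n f" and r: "r = r_of n f" "r \<le> 1"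
  shows "spectral_norm n f \<le> 5"
  using assms(1-3) r(1)
proof (cases rule: spectral_norm_profile)
  case (1 F c)
  have "spectral_norm n f \<le> 1 + 4 * (\<Sum>k<r. real (n choose k))"
    unfolding 1(2) by (rule layer_norm_le_binomial_sum[OF _ 1(1,3,5)]) (use 1(4) in auto)
  also have "(\<Sum>k<r. real (n choose k)) \<le> 1" using r(2) by (cases r) auto
  finally show ?thesis by simp
next
  case (2 F)
  have "r = 1" using 2(3) r(2) by simp
  then have "spectral_norm n f \<le> 2 ^ 2"
    using layer_norm_le_two_power[of F 2] 2(1,2,4) by simp
  then show ?thesis by simp
qed

section \<open>Logarithmic bounds with absolute constants\<close>

lemma log_spectral_norm_bounds:
  assumes "1 \<le> n" "sign_valued n f" "symmetric_fun n f" and r: "r = r_of n f" "2 \<le> r"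
  shows "1 / 133 * real r * log 2 (real n / real r) \<le> log 2 (spectral_norm n f)"
    and "log 2 (spectral_norm n f) \<le> 6 * real r * log 2 (real n / real r)"
proof -
  have q: "2 \<le> real n / real r"
    using assms(1-3) r(1)
  proof (cases rule: spectral_norm_profile)
    case (1 F c)
    show ?thesis using 1(4) r(2) by (simp add: le_divide_eq)
  next
    case (2 F)
    show ?thesis using 2(3,4) by simp
  qed
  have ge1: "1 \<le> spectral_norm n f" using assms(2,3) by (rule spectral_norm_ge_1)
  have "spectral_norm n f \<le> (real n / real r) ^ (6 * r)"
    using assms(1-3) r(1) by (rule spectral_norm_upper) (use r(2) in simp)
  then show "log 2 (spectral_norm n f) \<le> 6 * real r * log 2 (real n / real r)"
    using log_bounds_of_power[of "real n / real r" "spectral_norm n f" "6 * r"] q ge1 by simp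
  show "1 / 133 * real r * log 2 (real n / real r) \<le> log 2 (spectral_norm n f)"
  \<comment> \<open>Below the threshold, \<open>n / r\<close> is less than \<open>2 ^ 19\<close>, so
    the bound \<open>r / 7\<close> suffices with the constant 1/133 = 1/(7 * 19).\<close>
  proof (cases "331776 \<le> real n / real r")
    case True
    have "1 / 133 * real r * log 2 (real n / real r) \<le> real r / 8 * log 2 (real n / real r)"
      using q by (intro mult_right_mono) auto
    also have "\<dots> \<le> log 2 (spectral_norm n f)"
      using assms True by (rule spectral_norm_lower_log)
    finally show ?thesis .
  next
    case False
    then have "log 2 (real n / real r) \<le> log 2 (2 ^ 19)"
      using q by (subst log_le_cancel_iff) auto
    also have "\<dots> = 19" by (subst log_nat_power) auto
    finally have "1 / 133 * real r * log 2 (real n / real r) \<le> 1 / 133 * real r * 19"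
      by (intro mult_left_mono) auto
    also have "\<dots> = log 2 (2 powr (r / 7))" by simp
    also have "\<dots> \<le> log 2 (spectral_norm n f)"
      using spectral_norm_lower_exp[OF assms] ge1 by (subst log_le_cancel_iff) auto
    finally show ?thesis .
  qed
qed

theorem theorem1:
  shows "(\<exists>c1 c2 :: real. 0 < c1 \<and> c1 \<le> c2 \<and>
           (\<forall>n :: nat. \<forall>f :: (nat \<Rightarrow> nat) \<Rightarrow> real.
              n \<ge> 1 \<longrightarrow> sign_valued n f \<longrightarrow> symmetric_fun n f \<longrightarrow> r_of n f > 1 \<longrightarrow>
              c1 * real (r_of n f) * log 2 (real n / real (r_of n f)) \<le> log 2 (spectral_norm n f) \<and>
              log 2 (spectral_norm n f) \<le> c2 * real (r_of n f) * log 2 (real n / real (r_of n f))))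
       \<and> (\<exists>C1 C2 :: real. 0 < C1 \<and> C1 \<le> C2 \<and>
           (\<forall>n :: nat. \<forall>f :: (nat \<Rightarrow> nat) \<Rightarrow> real.
              n \<ge> 1 \<longrightarrow> sign_valued n f \<longrightarrow> symmetric_fun n f \<longrightarrow> r_of n f \<le> 1 \<longrightarrow>
              C1 \<le> spectral_norm n f \<and> spectral_norm n f \<le> C2))"
proof (rule conjI)
  show "\<exists>c1 c2 :: real. 0 < c1 \<and> c1 \<le> c2 \<and>
           (\<forall>n :: nat. \<forall>f :: (nat \<Rightarrow> nat) \<Rightarrow> real.
              n \<ge> 1 \<longrightarrow> sign_valued n f \<longrightarrow> symmetric_fun n f \<longrightarrow> r_of n f > 1 \<longrightarrow>
              c1 * real (r_of n f) * log 2 (real n / real (r_of n f)) \<le> log 2 (spectral_norm n f) \<and>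
              log 2 (spectral_norm n f) \<le> c2 * real (r_of n f) * log 2 (real n / real (r_of n f)))"
    by (rule exI[of _ "1 / 133"], rule exI[of _ 6]) (use log_spectral_norm_bounds in auto)
  show "\<exists>C1 C2 :: real. 0 < C1 \<and> C1 \<le> C2 \<and>
           (\<forall>n :: nat. \<forall>f :: (nat \<Rightarrow> nat) \<Rightarrow> real.
              n \<ge> 1 \<longrightarrow> sign_valued n f \<longrightarrow> symmetric_fun n f \<longrightarrow> r_of n f \<le> 1 \<longrightarrow>
              C1 \<le> spectral_norm n f \<and> spectral_norm n f \<le> C2)"
    by (rule exI[of _ 1], rule exI[of _ 5]) (use spectral_norm_ge_1 spectral_norm_le_5 in auto)
qed

end
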